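(* (1) $\operatorname{Aut}(Y_{1,3})\cong D_4\times C_2$. (2) For all integers $n\ge1$ and $m\ge0$ with $m\neq2$ and $(n,m)\neq(1,3)$, $\operatorname{Aut}(Y_{n,m})\cong A_{n,m}$, where $A_{n,m}=\langle\varphi,\psi,\tau\rangle\le\operatorname{Aut}(Y_{n,m})$.
   Context: For integers $n\ge1$, $m\ge0$, the Yoke graph $Y_{n,m}$ has vertices the tuples $v=(v_0,\dots,v_{m+1})$ with $v_0,v_{m+1}\in\mathbb{Z}_n$, $v_1,\dots,v_m\in\{0,1\}$, $\sum v_i\equiv0\pmod n$; $u\sim v$ iff there is $0\le i\le m$ with $u_j=v_j$ for $j\notin\{i,i+1\}$ and either ($u_i=v_i+1$, $u_{i+1}=v_{i+1}-1$) or ($u_i=v_i-1$, $u_{i+1}=v_{i+1}+1$), bucket entries computed mod $n$. Define (bucket entries mod $n$): $\varphi(v_0,v_1,\dots,v_m,v_{m+1})=(v_0+1,v_1,\dots,v_m,v_{m+1}-1)$; $\psi(v_0,\dots,v_{m+1})=(v_{m+1},v_m,\dots,v_1,v_0)$; $\tau(v_0,v_1,\dots,v_m,v_{m+1})=(-v_0,1-v_1,\dots,1-v_m,-(m+v_{m+1}))$; these are automorphisms of $Y_{n,m}$ and $A_{n,m}$ is the subgroup they generate. $C_2$ is cyclic of order 2 and $D_4$ is the dihedral group of order 8. *)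

theory Defs
  imports "HOL-Algebra.Algebra"
begin

text \<open>Vertices of the Yoke graph Y(n,m) are int lists v of length m+2;
  entries 0 and m+1 are the buckets (in Z_n, represented by 0..n-1),
  entries 1..m are in {0,1}, and the total sum is divisible by n.\<close>

definition yoke_verts :: "nat \<Rightarrow> nat \<Rightarrow> int list set" where
  "yoke_verts n m = {v. length v = m + 2
      \<and> v ! 0 \<in> {0..<int n} \<and> v ! (m+1) \<in> {0..<int n}
      \<and> (\<forall>i. 1 \<le> i \<and> i \<le> m \<longrightarrow> v ! i \<in> {0, 1})
      \<and> sum_list v mod int n = 0}"

definition yoke_shift :: "nat \<Rightarrow> nat \<Rightarrow> nat \<Rightarrow> int \<Rightarrow> int \<Rightarrow> int" where
  "yoke_shift n m j x d = (if j = 0 \<or> j = m + 1 then (x + d) mod int n else x + d)"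

definition yoke_adj :: "nat \<Rightarrow> nat \<Rightarrow> int list \<Rightarrow> int list \<Rightarrow> bool" where
  "yoke_adj n m u v \<longleftrightarrow> u \<in> yoke_verts n m \<and> v \<in> yoke_verts n m \<and>
     (\<exists>i \<le> m. (\<forall>j < m + 2. j \<noteq> i \<and> j \<noteq> i + 1 \<longrightarrow> u ! j = v ! j) \<and>
        ((u ! i = yoke_shift n m i (v ! i) 1 \<and> u ! (i+1) = yoke_shift n m (i+1) (v ! (i+1)) (-1))
       \<or> (u ! i = yoke_shift n m i (v ! i) (-1) \<and> u ! (i+1) = yoke_shift n m (i+1) (v ! (i+1)) 1)))"

definition yoke_aut :: "nat \<Rightarrow> nat \<Rightarrow> (int list \<Rightarrow> int list) monoid" where
  "yoke_aut n m = (BijGroup (yoke_verts n m))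
     \<lparr>carrier := {f \<in> Bij (yoke_verts n m).
        \<forall>u \<in> yoke_verts n m. \<forall>v \<in> yoke_verts n m.
          yoke_adj n m u v \<longleftrightarrow> yoke_adj n m (f u) (f v)}\<rparr>"

definition yoke_phi :: "nat \<Rightarrow> nat \<Rightarrow> int list \<Rightarrow> int list" where
  "yoke_phi n m = (\<lambda>v \<in> yoke_verts n m.
     v[0 := (v ! 0 + 1) mod int n, m + 1 := (v ! (m+1) - 1) mod int n])"

definition yoke_psi :: "nat \<Rightarrow> nat \<Rightarrow> int list \<Rightarrow> int list" where
  "yoke_psi n m = (\<lambda>v \<in> yoke_verts n m. rev v)"

definition yoke_tau :: "nat \<Rightarrow> nat \<Rightarrow> int list \<Rightarrow> int list" where
  "yoke_tau n m = (\<lambda>v \<in> yoke_verts n m.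
     map (\<lambda>i. if i = 0 then (- (v ! 0)) mod int n
              else if i = m + 1 then (- (int m + v ! (m+1))) mod int n
              else 1 - v ! i) [0..<m+2])"

definition yoke_A :: "nat \<Rightarrow> nat \<Rightarrow> (int list \<Rightarrow> int list) monoid" where
  "yoke_A n m = (yoke_aut n m)
     \<lparr>carrier := generate (yoke_aut n m) {yoke_phi n m, yoke_psi n m, yoke_tau n m}\<rparr>"

text \<open>Dihedral group of order 8 as Z_4 \<rtimes> Z_2: (a,s)(b,t) = (a + (-1)^s b, s + t).\<close>
definition dihedral4 :: "(int \<times> int) monoid" where
  "dihedral4 = \<lparr>carrier = {0..<4} \<times> {0..<2},
     monoid.mult = (\<lambda>(a, s) (b, t). ((a + (if s = 0 then b else - b)) mod 4, (s + t) mod 2)),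
     one = (0, 0)\<rparr>"

definition cyclic2 :: "int monoid" where
  "cyclic2 = integer_mod_group 2"

end

theory Submission
  imports Defs
begin

text \<open>
  A vertex of \<open>Y(n,m)\<close> is encoded by its partial sums: a height function \<open>s\<close> on \<open>0..m\<close> with steps in
  \<open>{0,1}\<close>, taken modulo a common translation by \<open>n\<close>; an edge changes a single height by \<open>\<plusminus>1\<close>. Two moves
  at non-adjacent indices span a 4-cycle, and for \<open>m \<ge> 3\<close> and \<open>(m+1)n > 4\<close> a pair of neighbours of a
  vertex lies in at most one 4-cycle through it; this is what fails for \<open>(n,m) = (1,3)\<close>.

  Let an automorphism fix the zero vertex and both of its neighbours. It fixes every vertex, by induction
  on \<open>d(s) = \<Sum>|s k|\<close>: if two moves decrease \<open>d\<close>, then \<open>s\<close> completes a 4-cycle of fixed vertices;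
  otherwise \<open>s\<close> has a single neighbour \<open>w\<close> closer to zero, and \<open>s\<close> is the only neighbour of \<open>w\<close> not
  known to be fixed, apart from one pair above \<open>w = (0,\<dots>,0,1,1)\<close>, which is told apart by degrees
  (\<open>m \<ge> 4\<close>) or by counting common neighbours (\<open>m = 3\<close>). Since the vertices of degree at most 2 are the
  constant ones, on which \<open>\<phi>\<close> and \<open>\<tau>\<close> act transitively, and \<open>\<psi>\<close> swaps the two neighbours of zero,
  every automorphism lies in \<open>A(n,m)\<close>.

  The graph \<open>Y(1,3)\<close> consists of a cyclically ordered quadruple \<open>P\<close>, two vertices \<open>Q\<close> each joined to one
  diagonal of \<open>P\<close>, and two vertices \<open>R\<close> joined to all of \<open>P\<close>; the dihedral group acts on \<open>P\<close> and \<open>Q\<close>,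
  the cyclic group on \<open>R\<close>.
\<close>

section \<open>Height functions\<close>

locale yoke =
  fixes n m :: nat
  assumes n_pos: "n \<ge> 1"
begin

definition path :: "(nat \<Rightarrow> int) \<Rightarrow> bool" where
  "path s \<longleftrightarrow> (\<forall>k<m. s (Suc k) - s k \<in> {0, 1})"

text \<open>The inner entries are the steps of \<open>s\<close>, and the last bucket is forced
  because the total must vanish modulo \<open>n\<close>. Heights beyond index \<open>m\<close> are
  ignored, so later equalities of height functions are only required on \<open>0..m\<close>.\<close>

definition vert :: "(nat \<Rightarrow> int) \<Rightarrow> int list" where
  "vert s = map (\<lambda>i. if i = 0 then s 0 mod int n
                     else if i = m + 1 then (- s m) mod int n
                     else s i - s (i - 1)) [0..<m + 2]"

text \<open>Passing a unit between entries \<open>i\<close> and \<open>i + 1\<close> of the tuple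
  changes the partial sum at \<open>i\<close> and no other, so this is the effect of one
  edge.\<close>

definition bump :: "(nat \<Rightarrow> int) \<Rightarrow> nat \<Rightarrow> int \<Rightarrow> nat \<Rightarrow> int" where
  "bump s i e = s(i := s i + e)"

lemma length_vert [simp]: "length (vert s) = m + 2"
  by (simp add: vert_def)

lemma vert_nth: "i < m + 2 \<Longrightarrow> vert s ! i = (if i = 0 then s 0 mod int n
    else if i = m + 1 then (- s m) mod int n else s i - s (i - 1))"
  unfolding vert_def by (subst nth_map) (simp_all del: upt_Suc)

lemma vert_nths: "vert s ! 0 = s 0 mod int n" "vert s ! Suc m = (- s m) mod int n"
  "k < m \<Longrightarrow> vert s ! Suc k = s (Suc k) - s k"
  by (auto simp: vert_nth)

lemma sum_list_vert: "sum_list (vert s) = s 0 mod int n + (s m - s 0) + (- s m) mod int n"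
proof -
  have "sum_list (vert s) = (\<Sum>i<m+2. vert s ! i)"
    by (simp add: sum_list_sum_nth atLeast0LessThan)
  also have "\<dots> = vert s ! 0 + (\<Sum>i<m. vert s ! Suc i) + vert s ! Suc m"
    by (simp only: add_2_eq_Suc' sum.lessThan_Suc) (simp only: sum.lessThan_Suc_shift flip: sum.lessThan_Suc)
  also have "(\<Sum>i<m. vert s ! Suc i) = (\<Sum>i<m. s (Suc i) - s i)"
    by (rule sum.cong) (auto simp: vert_nths)
  also have "\<dots> = s m - s 0" by (rule sum_lessThan_telescope)
  finally show ?thesis by (simp add: vert_nths)
qed

text \<open>The total is congruent to \<open>s 0 + (s m - s 0) - s m = 0\<close>, so divisibility by
  \<open>n\<close> is automatic and only the step condition remains.\<close>

lemma vert_in_iff: "vert s \<in> yoke_verts n m \<longleftrightarrow> path s"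
proof -
  have "(s 0 mod int n + (s m - s 0) + (- s m) mod int n) mod int n
      = (s 0 + (s m - s 0) + - s m) mod int n"
    by (metis mod_add_left_eq mod_add_right_eq)
  then have sm: "sum_list (vert s) mod int n = 0" by (simp add: sum_list_vert)
  have "(\<forall>i. 1 \<le> i \<and> i \<le> m \<longrightarrow> vert s ! i \<in> {0, 1}) \<longleftrightarrow> path s" (is "?L \<longleftrightarrow> _")
  proof
    assume L: ?L
    show "path s" unfolding path_def
    proof (intro allI impI)
      fix k assume "k < m"
      then show "s (Suc k) - s k \<in> {0, 1}"
        using L[rule_format, of "Suc k"] by (simp add: vert_nths)
    qed
  next
    assume P: "path s"
    show ?L
    proof (intro allI impI)
      fix i assume i: "1 \<le> i \<and> i \<le> m"
      then obtain k where "i = Suc k" "k < m" by (cases i) auto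
      then show "vert s ! i \<in> {0, 1}" using P by (simp add: vert_nths path_def)
    qed
  qed
  then show ?thesis using sm n_pos by (simp add: yoke_verts_def vert_nths)
qed

lemma vert_eqI:
  assumes "\<And>k. k \<le> m \<Longrightarrow> s k = t k + c * int n"
  shows "vert s = vert t"
proof -
  have "(- (t m + c * int n)) mod int n = (- t m) mod int n"
    by (metis add.commute minus_add_distrib mod_mult_self1 mult_minus_left)
  then show ?thesis
    using assms by (intro nth_equalityI) (auto simp: vert_nth)
qed

text \<open>The first bucket fixes \<open>s 0\<close> modulo \<open>n\<close> and the inner entries
  fix all increments, so a common translation is the only freedom left.\<close>

lemma vert_eqD:
  assumes "vert s = vert t"
  obtains c where "\<And>k. k \<le> m \<Longrightarrow> s k = t k + c * int n"
proof -
  have "s 0 mod int n = t 0 mod int n" using assms vert_nths(1) by metis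
  then obtain c where c: "s 0 = t 0 + c * int n"
    by (metis mod_eqE mult.commute add.commute diff_add_cancel mod_eq_dvd_iff dvd_def)
  have "k \<le> m \<Longrightarrow> s k = t k + c * int n" for k
  proof (induction k)
    case (Suc k)
    then have "s (Suc k) - s k = t (Suc k) - t k"
      using assms vert_nths(3)[of k s] vert_nths(3)[of k t] by simp
    then show ?case using Suc by simp
  qed (simp add: c)
  then show thesis using that by blast
qed

text \<open>The partial sums of \<open>v\<close> serve as heights. They are nonnegative since all
  entries are, which places every vertex in the cone of the later induction.\<close>

lemma vert_surj:
  assumes "v \<in> yoke_verts n m"
  obtains s where "path s" "\<And>k. k \<le> m \<Longrightarrow> s k \<ge> 0" "v = vert s"
proof -
  define s where "s k = (\<Sum>i\<le>k. v ! i)" for k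
  have v: "length v = m + 2" "v ! 0 \<in> {0..<int n}" "v ! (m+1) \<in> {0..<int n}"
      "\<And>i. 1 \<le> i \<Longrightarrow> i \<le> m \<Longrightarrow> v ! i \<in> {0, 1}" "sum_list v mod int n = 0"
    using assms by (auto simp: yoke_verts_def)
  have "sum_list v = s m + v ! (m+1)"
    by (simp add: sum_list_sum_nth v(1) s_def atLeast0LessThan lessThan_Suc_atMost)
  then have "int n dvd v ! (m+1) - (- s m)" using v(5) by (simp add: dvd_eq_mod_eq_0 add.commute)
  then have "v ! (m+1) mod int n = (- s m) mod int n" by (simp only: mod_eq_dvd_iff)
  then have last: "v ! (m+1) = (- s m) mod int n" using v(3) by simp
  have "v = vert s"
  proof (rule nth_equalityI)
    fix i assume "i < length v"
    then have i: "i < m + 2" using v by simp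
    show "v ! i = vert s ! i"
    proof (cases "i = 0 \<or> i = m + 1")
      case True
      then show ?thesis using last v(2) by (auto simp: vert_nths s_def)
    next
      case False
      with i obtain k where "i = Suc k" "k < m" by (cases i) auto
      then show ?thesis by (simp add: vert_nths s_def)
    qed
  qed (simp add: v)
  moreover have "s k \<ge> 0" if "k \<le> m" for k unfolding s_def
  proof (rule sum_nonneg)
    fix i assume "i \<in> {..k}"
    then show "0 \<le> v ! i" using v(2) v(4)[of i] that by (cases "i = 0") fastforce+
  qed
  moreover have "path s" using assms vert_in_iff \<open>v = vert s\<close> by simp
  ultimately show thesis using that by blast
qed

lemma vert_bump:
  assumes "i \<le> m"
  shows "vert (bump s i e) ! i = yoke_shift n m i (vert s ! i) e"
    "vert (bump s i e) ! (i+1) = yoke_shift n m (i+1) (vert s ! (i+1)) (- e)"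
    "\<And>j. j < m + 2 \<Longrightarrow> j \<noteq> i \<Longrightarrow> j \<noteq> i + 1 \<Longrightarrow> vert (bump s i e) ! j = vert s ! j"
proof -
  show "vert (bump s i e) ! i = yoke_shift n m i (vert s ! i) e"
    using assms by (auto simp: vert_nth bump_def yoke_shift_def mod_add_left_eq)
  show "vert (bump s i e) ! (i+1) = yoke_shift n m (i+1) (vert s ! (i+1)) (- e)"
    using assms by (auto simp: vert_nth bump_def yoke_shift_def mod_add_left_eq mod_diff_left_eq minus_diff_commute)
  show "\<And>j. j < m + 2 \<Longrightarrow> j \<noteq> i \<Longrightarrow> j \<noteq> i + 1 \<Longrightarrow> vert (bump s i e) ! j = vert s ! j"
    by (auto simp: vert_nth bump_def)
qed

lemma eq_vert_bump_iff:
  assumes "i \<le> m" "length u = m + 2"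
  shows "u = vert (bump s i e) \<longleftrightarrow> u ! i = yoke_shift n m i (vert s ! i) e
    \<and> u ! (i+1) = yoke_shift n m (i+1) (vert s ! (i+1)) (- e)
    \<and> (\<forall>j < m + 2. j \<noteq> i \<and> j \<noteq> i + 1 \<longrightarrow> u ! j = vert s ! j)" (is "_ \<longleftrightarrow> ?R")
proof
  assume ?R
  show "u = vert (bump s i e)"
  proof (rule nth_equalityI)
    fix j assume "j < length u"
    then show "u ! j = vert (bump s i e) ! j"
      using \<open>?R\<close> assms vert_bump[OF assms(1), where s = s and e = e] by (cases "j = i \<or> j = i + 1") auto
  qed (simp add: assms)
qed (use vert_bump[OF assms(1), where s = s and e = e] in auto)

lemma adj_vert:
  assumes "path t"
  shows "yoke_adj n m u (vert t) \<longleftrightarrow>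
    (\<exists>i\<le>m. \<exists>e\<in>{1, -1}. path (bump t i e) \<and> u = vert (bump t i e))" (is "_ \<longleftrightarrow> ?R")
proof -
  have "yoke_adj n m u (vert t) \<longleftrightarrow> u \<in> yoke_verts n m \<and>
      (\<exists>i\<le>m. u = vert (bump t i 1) \<or> u = vert (bump t i (- 1)))"
  proof -
    have "vert t \<in> yoke_verts n m" using assms vert_in_iff by simp
    moreover have "length u = m + 2" if "u \<in> yoke_verts n m"
      using that by (simp add: yoke_verts_def)
    ultimately show ?thesis
      unfolding yoke_adj_def using eq_vert_bump_iff[of _ u t 1] eq_vert_bump_iff[of _ u t "- 1", unfolded minus_minus]
      by (smt (verit))
  qed
  also have "\<dots> \<longleftrightarrow> ?R" by (auto simp: vert_in_iff)
  finally show ?thesis .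
qed

lemma bump_bump [simp]: "bump (bump s i e) i (- e) = s" "bump (bump s i (- e)) i e = s"
  by (auto simp: bump_def)

lemma adj_sym: "yoke_adj n m u v \<longleftrightarrow> yoke_adj n m v u"
proof -
  have "yoke_adj n m v u" if uv: "yoke_adj n m u v" for u v
  proof -
    have "v \<in> yoke_verts n m" using uv by (simp add: yoke_adj_def)
    then obtain t where t: "path t" "v = vert t" by (rule vert_surj)
    with uv obtain i e where i: "i \<le> m" "e \<in> {1, -1}" "path (bump t i e)" "u = vert (bump t i e)"
      by (auto simp: adj_vert)
    moreover have "v = vert (bump (bump t i e) i (- e))" using t by simp
    moreover have "- e \<in> {1, - 1}" using i by auto
    ultimately show ?thesis using t by (metis adj_vert bump_bump(1))
  qed
  then show ?thesis by blast
qed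

section \<open>Moves that a path admits\<close>

lemma path_step: "path s \<Longrightarrow> k < m \<Longrightarrow> s (Suc k) = s k \<or> s (Suc k) = s k + 1"
  unfolding path_def by force

lemma path_pred: "path s \<Longrightarrow> 0 < k \<Longrightarrow> k \<le> m \<Longrightarrow> s k = s (k - 1) \<or> s k = s (k - 1) + 1"
  using path_step[of s "k - 1"] by simp

lemma path_mono:
  assumes "path s" "i \<le> j" "j \<le> m"
  shows "s i \<le> s j"
  using assms(2,3)
proof (induction j rule: dec_induct)
  case (step j)
  then show ?case using path_step[OF assms(1), of j] by auto
qed simp

text \<open>Lowering at \<open>i\<close> turns the steps around \<open>i\<close> from
  \<open>1, 0\<close> into \<open>0, 1\<close>; an end index has only one of the two steps. Raising
  is the reverse exchange.\<close>

lemma path_bump_down: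
  assumes "path s" "i \<le> m"
  shows "path (bump s i (- 1)) \<longleftrightarrow> (i = 0 \<or> s (i - 1) < s i) \<and> (i = m \<or> s (Suc i) = s i)"
proof
  assume P: "path (bump s i (- 1))"
  have "s (i - 1) < s i" if "i \<noteq> 0"
  proof -
    have "i - 1 \<noteq> i" using that by simp
    then show ?thesis using path_pred[OF P, of i] that assms by (auto simp: bump_def)
  qed
  moreover have "s (Suc i) = s i" if "i \<noteq> m"
    using path_step[OF P, of i] path_step[OF assms(1), of i] that assms by (auto simp: bump_def)
  ultimately show "(i = 0 \<or> s (i - 1) < s i) \<and> (i = m \<or> s (Suc i) = s i)" by blast
next
  assume R: "(i = 0 \<or> s (i - 1) < s i) \<and> (i = m \<or> s (Suc i) = s i)"
  show "path (bump s i (- 1))" unfolding path_def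
  proof (intro allI impI)
    fix k assume "k < m"
    then show "bump s i (- 1) (Suc k) - bump s i (- 1) k \<in> {0, 1}"
      using R path_step[OF assms(1), of k] by (auto simp: bump_def)
  qed
qed

lemma path_bump_up:
  assumes "path s" "i \<le> m"
  shows "path (bump s i 1) \<longleftrightarrow> (i = 0 \<or> s (i - 1) = s i) \<and> (i = m \<or> s i < s (Suc i))"
proof
  assume P: "path (bump s i 1)"
  have "s (i - 1) = s i" if "i \<noteq> 0"
  proof -
    have "i - 1 \<noteq> i" using that by simp
    then show ?thesis
      using path_pred[OF P, of i] path_pred[OF assms(1), of i] that assms by (auto simp: bump_def)
  qed
  moreover have "s i < s (Suc i)" if "i \<noteq> m"
    using path_step[OF P, of i] that assms by (auto simp: bump_def)
  ultimately show "(i = 0 \<or> s (i - 1) = s i) \<and> (i = m \<or> s i < s (Suc i))" by blast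
next
  assume R: "(i = 0 \<or> s (i - 1) = s i) \<and> (i = m \<or> s i < s (Suc i))"
  show "path (bump s i 1)" unfolding path_def
  proof (intro allI impI)
    fix k assume "k < m"
    then show "bump s i 1 (Suc k) - bump s i 1 k \<in> {0, 1}"
      using R path_step[OF assms(1), of k] by (auto simp: bump_def)
  qed
qed

end
section \<open>Squares and neighbourhoods\<close>

context yoke begin

definition nbrs :: "int list \<Rightarrow> int list set" where
  "nbrs v = {u. yoke_adj n m u v}"

lemma mem_nbrs_vert:
  "path t \<Longrightarrow> u \<in> nbrs (vert t) \<longleftrightarrow>
    (\<exists>i\<le>m. \<exists>e\<in>{1, -1}. path (bump t i e) \<and> u = vert (bump t i e))"
  by (simp add: nbrs_def adj_vert)

lemma vert_bump_in_nbrs: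
  assumes "path t" "i \<le> m" "e \<in> {1, -1}" "path (bump t i e)"
  shows "vert (bump t i e) \<in> nbrs (vert t)"
  unfolding mem_nbrs_vert[OF assms(1)] using assms(2-4) by (intro exI[of _ i] conjI bexI[of _ e]) auto

lemma nbrs_subsetI:
  assumes "path t"
    and "\<And>i e. i \<le> m \<Longrightarrow> e \<in> {1, -1} \<Longrightarrow> path (bump t i e) \<Longrightarrow> vert (bump t i e) \<in> A"
  shows "nbrs (vert t) \<subseteq> A"
proof
  fix u assume "u \<in> nbrs (vert t)"
  then obtain i e where "i \<le> m" "e \<in> {1, -1}" "path (bump t i e)" "u = vert (bump t i e)"
    unfolding mem_nbrs_vert[OF assms(1)] by auto
  then show "u \<in> A" using assms(2)[of i e] by simp
qed

lemma finite_nbrs: "v \<in> yoke_verts n m \<Longrightarrow> finite (nbrs v)"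
proof -
  assume "v \<in> yoke_verts n m"
  then obtain t where t: "path t" "v = vert t" by (rule vert_surj)
  have "nbrs v \<subseteq> (\<lambda>(i, e). vert (bump t i e)) ` ({..m} \<times> {1, -1})"
    using t by (auto simp: mem_nbrs_vert)
  then show ?thesis by (rule finite_subset) simp
qed

text \<open>One of the indices 0, 1, 2 avoids both \<open>i\<close> and \<open>j\<close>. Heights
  bumped only at \<open>i\<close> and \<open>j\<close> agree there, which rules out a nonzero
  translation in the next two lemmas.\<close>

lemma other_index:
  assumes "m \<ge> 2"
  obtains p where "p \<le> m" "p \<noteq> i" "p \<noteq> j"
proof -
  consider "0 \<noteq> i \<and> 0 \<noteq> j" | "1 \<noteq> i \<and> 1 \<noteq> j" | "2 \<noteq> i \<and> 2 \<noteq> j" by linarith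
  then show thesis using that assms by cases (metis le0, metis one_le_numeral order_trans, metis)
qed

lemma vert_bump_neq:
  assumes "m \<ge> 2" "i \<le> m" "i \<noteq> j" "e \<noteq> 0"
  shows "vert (bump s i e) \<noteq> vert (bump s j e')"
proof
  assume "vert (bump s i e) = vert (bump s j e')"
  then obtain c where c: "\<And>k. k \<le> m \<Longrightarrow> bump s i e k = bump s j e' k + c * int n"
    by (rule vert_eqD) blast
  obtain p where "p \<le> m" "p \<noteq> i" "p \<noteq> j" using other_index[OF assms(1)] by blast
  then have "c * int n = 0" using c[of p] by (simp add: bump_def)
  then show False using c[of i] assms by (simp add: bump_def)
qed

lemma vert_bump2_neq:
  assumes "m \<ge> 2" "i \<le> m" "i \<noteq> j" "e \<noteq> 0"
  shows "vert (bump (bump s i e) j e') \<noteq> vert s"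
proof
  assume "vert (bump (bump s i e) j e') = vert s"
  then obtain c where c: "\<And>k. k \<le> m \<Longrightarrow> bump (bump s i e) j e' k = s k + c * int n"
    by (rule vert_eqD) blast
  obtain p where "p \<le> m" "p \<noteq> i" "p \<noteq> j" using other_index[OF assms(1)] by blast
  then have "c * int n = 0" using c[of p] by (simp add: bump_def)
  then show False using c[of i] assms by (simp add: bump_def)
qed

text \<open>Moves at different indices lead to different neighbours, so the number of movable
  indices bounds the degree from below.\<close>

lemma card_nbrs_ge:
  assumes "m \<ge> 2" "path s" "I \<subseteq> {..m}" "\<And>i. i \<in> I \<Longrightarrow> \<exists>e\<in>{1, -1}. path (bump s i e)"
  shows "card I \<le> card (nbrs (vert s))"
proof -
  obtain e where e: "\<And>i. i \<in> I \<Longrightarrow> e i \<in> {1, -1} \<and> path (bump s i (e i))"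
    using assms(4) by metis
  have "inj_on (\<lambda>i. vert (bump s i (e i))) I"
  proof (rule inj_onI, rule ccontr)
    fix i j assume ij: "i \<in> I" "j \<in> I" "vert (bump s i (e i)) = vert (bump s j (e j))" "i \<noteq> j"
    have "e i \<noteq> 0" using e[OF ij(1)] by auto
    then show False using vert_bump_neq[OF assms(1) _ ij(4)] ij assms(3) by blast
  qed
  moreover have "(\<lambda>i. vert (bump s i (e i))) ` I \<subseteq> nbrs (vert s)"
    using e assms by (fastforce simp: mem_nbrs_vert)
  moreover have "finite (nbrs (vert s))" using assms finite_nbrs vert_in_iff by simp
  ultimately show ?thesis by (rule card_inj_on_le)
qed

lemma bump_apply: "bump s i e p = s p + (if p = i then e else 0)"
  by (simp add: bump_def)

text \<open>Two distinct two-step walks from \<open>s\<close> with the same end differ, as height functions, by a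
  multiple of \<open>n\<close> that is constant on \<open>m + 1\<close> indices while having total variation at most 4.\<close>

lemma square:
  assumes nm: "(m + 1) * n > 4" and ij: "i \<le> m" "j \<le> m" "i \<noteq> j"
    and e: "e \<in> {1, -1}" "e' \<in> {1, -1}"
    and s: "path (bump s i e)" "path (bump s j e')"
    and y: "y \<in> nbrs (vert (bump s i e))" "y \<in> nbrs (vert (bump s j e'))" "y \<noteq> vert s"
  shows "path (bump (bump s i e) j e')" "y = vert (bump (bump s i e) j e')"
proof -
  obtain k a where k: "k \<le> m" "a \<in> {1, -1}" "path (bump (bump s i e) k a)"
      "y = vert (bump (bump s i e) k a)"
    using y(1) mem_nbrs_vert[OF s(1)] by blast
  obtain l b where l: "l \<le> m" "b \<in> {1, -1}" "y = vert (bump (bump s j e') l b)"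
    using y(2) mem_nbrs_vert[OF s(2)] by blast
  obtain c where c: "\<And>p. p \<le> m \<Longrightarrow> bump (bump s i e) k a p = bump (bump s j e') l b p + c * int n"
    using k(4) l(3) vert_eqD by metis
  have ind: "\<bar>c * int n\<bar> \<le> (if p = i then 1 else 0) + (if p = k then 1 else 0)
      + (if p = j then 1 else 0) + (if p = l then 1 else 0)" if "p \<le> m" for p
  proof -
    have "c * int n = (if p = i then e else 0) + (if p = k then a else 0)
        - (if p = j then e' else 0) - (if p = l then b else 0)"
      using c[OF that] unfolding bump_apply by linarith
    moreover have "\<bar>if p = i then e else 0\<bar> \<le> (if p = i then 1 else 0)"
        "\<bar>if p = j then e' else 0\<bar> \<le> (if p = j then 1 else 0)"
        "\<bar>if p = k then a else 0\<bar> \<le> (if p = k then 1 else 0)"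
        "\<bar>if p = l then b else 0\<bar> \<le> (if p = l then 1 else 0)"
      using e k(2) l(2) by auto
    ultimately show ?thesis by linarith
  qed
  have "(\<Sum>p\<le>m. \<bar>c * int n\<bar>) \<le> (\<Sum>p\<le>m. (if p = i then 1 else 0) + (if p = k then 1 else 0)
      + (if p = j then 1 else 0) + (if p = l then 1 else (0::int)))"
    by (rule sum_mono) (use ind in simp)
  also have "\<dots> = 4" using ij k(1) l(1) by (simp add: sum.distrib)
  finally have le: "int (m + 1) * \<bar>c * int n\<bar> \<le> 4" by simp
  have c0: "c = 0"
  proof (rule ccontr)
    assume "c \<noteq> 0"
    then have "1 \<le> \<bar>c\<bar>" by linarith
    then have "int n \<le> \<bar>c * int n\<bar>" by (simp add: abs_mult mult_le_cancel_right1)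
    then have "int (m + 1) * int n \<le> 4" using le
      by (meson mult_left_mono of_nat_0_le_iff order_trans)
    then show False using nm by (metis not_le of_nat_le_iff of_nat_mult of_nat_numeral)
  qed
  have ci: "bump (bump s i e) k a i = bump (bump s j e') l b i" using c[OF ij(1)] c0 by simp
  have cj: "bump (bump s i e) k a j = bump (bump s j e') l b j" using c[OF ij(2)] c0 by simp
  \<comment> \<open>A second move at \<open>i\<close> could only undo the first and end in
    \<open>s\<close>, which is excluded. So the move at \<open>i\<close> has to be matched by the
    second move of the other walk, and comparing at \<open>j\<close> then determines
    \<open>k\<close> and \<open>a\<close>.\<close>
  have "k \<noteq> i"
  proof
    assume "k = i"
    then have "a = - e" using ci ij e k(2) l(2) by (auto simp: bump_def split: if_splits)
    then have "bump (bump s i e) k a = s" using \<open>k = i\<close> by simp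
    then show False using y(3) k(4) by simp
  qed
  then have "l = i" using ci ij e k(2) l(2) by (auto simp: bump_def split: if_splits)
  then have "k = j \<and> a = e'" using cj ij e k(2) l(2) by (auto simp: bump_def split: if_splits)
  then show "path (bump (bump s i e) j e')" "y = vert (bump (bump s i e) j e')"
    using k by auto
qed

text \<open>No step of the path touches both indices, so the two conditions do not interact.\<close>

lemma path_bump_bump:
  assumes "path (bump s i e)" "path (bump s j e')" "path s" "i \<noteq> j" "i \<noteq> Suc j" "j \<noteq> Suc i"
  shows "path (bump (bump s i e) j e')"
  unfolding path_def
proof (intro allI impI)
  fix k assume "k < m"
  then show "bump (bump s i e) j e' (Suc k) - bump (bump s i e) j e' k \<in> {0, 1}"
    using assms unfolding path_def by (auto simp: bump_def split: if_splits)
qed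

lemma down_exists:
  assumes "path s" "p \<le> m" "p = m \<or> s (Suc p) = s p"
  obtains i where "i \<le> p" "s i = s p" "path (bump s i (- 1))"
proof -
  \<comment> \<open>The first index of the plateau through \<open>p\<close>: a rise leads into it
    unless it is index 0, and the plateau continues after it unless it is \<open>m\<close>.\<close>
  define i where "i = (LEAST i. s i = s p)"
  have i: "s i = s p" unfolding i_def by (rule LeastI[of _ p]) simp
  have ip: "i \<le> p" unfolding i_def by (rule Least_le) simp
  have "s (i - 1) < s i" if "i \<noteq> 0"
  proof -
    have "s (i - 1) \<noteq> s p" using not_less_Least[of "i - 1" "\<lambda>i. s i = s p"] that i_def by simp
    then show ?thesis using path_pred[OF assms(1), of i] i ip assms(2) that by auto
  qed
  moreover have "s (Suc i) = s i" if "i \<noteq> m"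
  proof (cases "i = p")
    case True then show ?thesis using assms(3) that by auto
  next
    case False
    then show ?thesis using path_mono[OF assms(1), of i "Suc i"] path_mono[OF assms(1), of "Suc i" p]
      i ip assms(2) by simp
  qed
  ultimately have "path (bump s i (- 1))" using path_bump_down[OF assms(1), of i] ip assms(2) by auto
  then show thesis using that i ip by blast
qed

text \<open>This isolates the one configuration that the distance induction cannot settle by
  squares: \<open>w\<close> has two upper neighbours, each with a single lowering that decreases the
  distance. Every positive plateau followed by a flat step or by the end admits a lowering, so
  uniqueness leaves hardly any plateaus.\<close>

lemma common_lower_cover:
  assumes w: "path w" "\<And>p. p \<le> m \<Longrightarrow> w p \<ge> 0"
    and ik: "i < k" "k \<le> m" and m: "m \<noteq> 2"
    and s: "path (bump w i 1)" and t: "path (bump w k 1)"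
    and us: "\<And>j. j \<le> m \<Longrightarrow> path (bump (bump w i 1) j (- 1)) \<Longrightarrow> bump w i 1 j \<ge> 1 \<Longrightarrow> j = i"
    and ut: "\<And>j. j \<le> m \<Longrightarrow> path (bump (bump w k 1) j (- 1)) \<Longrightarrow> bump w k 1 j \<ge> 1 \<Longrightarrow> j = k"
  shows "m \<ge> 3 \<and> k = m \<and> i = m - 2 \<and> (\<forall>p\<le>m. w p = (if p \<ge> m - 1 then 1 else 0))"
proof -
  let ?s = "bump w i 1" and ?t = "bump w k 1"
  \<comment> \<open>The plateau through \<open>p\<close> can be lowered at its first index; by
    uniqueness this index is \<open>i\<close>, and likewise \<open>k\<close> for
    \<open>?t\<close>.\<close>
  have ds: "i \<le> p \<and> ?s i = ?s p" if "p \<le> m" "p = m \<or> ?s (Suc p) = ?s p" "?s p \<ge> 1" for p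
    using down_exists[OF s that(1,2)] us that by (metis order_trans)
  have dt: "k \<le> p \<and> ?t k = ?t p" if "p \<le> m" "p = m \<or> ?t (Suc p) = ?t p" "?t p \<ge> 1" for p
    using down_exists[OF t that(1,2)] ut that by (metis order_trans)
  have "?s i \<ge> 1" "?t k \<ge> 1" using w(2)[of i] w(2)[of k] ik by (auto simp: bump_def)
  then have "?s m \<ge> 1" "?t m \<ge> 1"
    using path_mono[OF s, of i m] path_mono[OF t, of k m] ik by auto
  then have sm: "?s i = ?s m" and tm: "?t k = ?t m" using ds[of m] dt[of m] by auto
  \<comment> \<open>For \<open>k < m\<close> the last plateau of \<open>?s\<close> makes
    \<open>w k = w m\<close>, while that of \<open>?t\<close> makes
    \<open>w k + 1 = w m\<close>.\<close>
  have km: "k = m"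
  proof (rule ccontr)
    assume "k \<noteq> m"
    then show False using sm tm path_mono[OF s, of i k] ik by (auto simp: bump_def)
  qed
  have wi: "w m = w i + 1" using sm ik km by (simp add: bump_def)
  have wp: "w p = w m" if "i < p" "p \<le> m" for p
    using path_mono[OF s, of i p] path_mono[OF s, of p m] sm that by (auto simp: bump_def)
  \<comment> \<open>Otherwise \<open>?t\<close> is flat between \<open>i + 1\<close> and
    \<open>i + 2\<close> at positive height, which yields a lowering before
    \<open>k = m\<close>.\<close>
  have i2: "m \<le> i + 2"
  proof (rule ccontr)
    assume "\<not> m \<le> i + 2"
    then show False using dt[of "Suc i"] wp[of "Suc i"] wp[of "Suc (Suc i)"] w(2)[of i] wi km
      by (auto simp: bump_def)
  qed
  \<comment> \<open>For \<open>i + 1 = m\<close> the last step of \<open>?t\<close> would be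
    2.\<close>
  have "Suc i \<noteq> m"
  proof
    assume "Suc i = m"
    then show False using path_step[OF t, of i] wi km by (auto simp: bump_def)
  qed
  with i2 ik km m have im: "i = m - 2" "m \<ge> 3" by auto
  \<comment> \<open>Otherwise \<open>?t\<close> has a flat step from \<open>i - 1\<close> to
    \<open>i\<close> at positive height, hence again a second lowering.\<close>
  have "w i = 0"
  proof (rule ccontr)
    assume "w i \<noteq> 0"
    then have "w i \<ge> 1" using w(2)[of i] ik by simp
    moreover have "w (i - 1) = w i"
      using path_pred[OF s, of i] path_pred[OF w(1), of i] im by (auto simp: bump_def split: if_splits)
    moreover have "Suc (i - 1) = i" "i - 1 \<noteq> m" "i \<noteq> m" "\<not> m \<le> i - 1" using im by auto
    ultimately show False using dt[of "i - 1"] ik km by (simp add: bump_def)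
  qed
  have "w p = (if p \<ge> m - 1 then 1 else 0)" if "p \<le> m" for p
  proof (cases "p \<le> i")
    case True
    then show ?thesis using path_mono[OF w(1) True] w(2)[OF that] \<open>w i = 0\<close> im by auto
  next
    case False
    then show ?thesis using wp[of p] wi \<open>w i = 0\<close> im that by auto
  qed
  then show ?thesis using im km by blast
qed

end
section \<open>Automorphisms fixing the zero vertex\<close>

context yoke begin

definition base :: "nat \<Rightarrow> int" where "base = (\<lambda>_. 0)"

definition dist0 :: "(nat \<Rightarrow> int) \<Rightarrow> int" where "dist0 s = (\<Sum>k\<le>m. \<bar>s k\<bar>)"

text \<open>Every vertex has a height function in this cone; the height \<open>-1\<close> at index 0 is allowed so that
  the cone contains both neighbours of zero.\<close>

definition near :: "(nat \<Rightarrow> int) \<Rightarrow> bool" where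
  "near s \<longleftrightarrow> path s \<and> s 0 \<ge> -1 \<and> (\<forall>k\<le>m. k > 0 \<longrightarrow> s k \<ge> 0)"

lemma dist0_bump:
  assumes "i \<le> m"
  shows "dist0 (bump s i e) = dist0 s - \<bar>s i\<bar> + \<bar>s i + e\<bar>"
proof -
  have "(\<Sum>k\<in>{..m} - {i}. \<bar>bump s i e k\<bar>) = (\<Sum>k\<in>{..m} - {i}. \<bar>s k\<bar>)"
    by (rule sum.cong) (auto simp: bump_def)
  then show ?thesis using assms unfolding dist0_def
    by (simp add: sum.remove[of "{..m}" i] bump_def)
qed

lemma dist0_nonneg: "dist0 s \<ge> 0"
  by (simp add: dist0_def sum_nonneg)

lemma path_base [simp]: "path base"
  by (simp add: path_def base_def)

lemma path_base_bump [simp]: "path (bump base 0 (- 1))" "path (bump base m 1)"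
  by (simp_all add: path_bump_down path_bump_up) (simp_all add: base_def)

text \<open>On a flat path an inner index can neither be lowered, which needs a rise before it, nor
  raised, which needs a rise after it; only the two ends move.\<close>

lemma nbrs_base: "nbrs (vert base) = {vert (bump base 0 (- 1)), vert (bump base m 1)}"
proof -
  have "nbrs (vert base) \<subseteq> {vert (bump base 0 (- 1)), vert (bump base m 1)}"
  proof (rule nbrs_subsetI[OF path_base])
    fix i e assume i: "i \<le> m" "e \<in> {1, - 1 :: int}" "path (bump base i e)"
    have "i = 0 \<and> e = -1 \<or> i = m \<and> e = 1"
      using i by (auto simp: path_bump_up path_bump_down) (auto simp: base_def)
    then show "vert (bump base i e) \<in> {vert (bump base 0 (- 1)), vert (bump base m 1)}" by auto
  qed
  moreover have "vert (bump base 0 (- 1)) \<in> nbrs (vert base)"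
    by (rule vert_bump_in_nbrs) simp_all
  moreover have "vert (bump base m 1) \<in> nbrs (vert base)"
    by (rule vert_bump_in_nbrs) simp_all
  ultimately show ?thesis by (intro equalityI) simp_all
qed

end

section \<open>Invariants of automorphisms and fixed corners of 4-cycles\<close>

locale yoke_automorphism = yoke +
  fixes f
  assumes bij: "bij_betw f (yoke_verts n m) (yoke_verts n m)"
    and adj: "\<And>u v. u \<in> yoke_verts n m \<Longrightarrow> v \<in> yoke_verts n m \<Longrightarrow>
      yoke_adj n m u v \<longleftrightarrow> yoke_adj n m (f u) (f v)"
begin

lemma f_in: "v \<in> yoke_verts n m \<Longrightarrow> f v \<in> yoke_verts n m"
  using bij bij_betwE by blast

lemma f_inj: "u \<in> yoke_verts n m \<Longrightarrow> v \<in> yoke_verts n m \<Longrightarrow> f u = f v \<longleftrightarrow> u = v"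
  using bij by (meson bij_betw_imp_inj_on inj_on_eq_iff)

lemma nbrs_sub: "nbrs v \<subseteq> yoke_verts n m"
  by (auto simp: nbrs_def yoke_adj_def)

lemma nbrs_image:
  assumes "v \<in> yoke_verts n m"
  shows "nbrs (f v) = f ` nbrs v"
proof (intro equalityI subsetI)
  fix u assume u: "u \<in> nbrs (f v)"
  then have "u \<in> yoke_verts n m" using nbrs_sub by blast
  then obtain w where w: "w \<in> yoke_verts n m" "u = f w"
    using bij by (metis bij_betw_imp_surj_on imageE)
  then show "u \<in> f ` nbrs v" using u adj[OF w(1) assms] by (auto simp: nbrs_def)
next
  fix u assume "u \<in> f ` nbrs v"
  then show "u \<in> nbrs (f v)" using adj[OF _ assms] nbrs_sub by (fastforce simp: nbrs_def)
qed

lemma card_nbrs: "v \<in> yoke_verts n m \<Longrightarrow> card (nbrs (f v)) = card (nbrs v)"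
  by (metis nbrs_image nbrs_sub bij bij_betw_imp_inj_on card_image inj_on_subset)

lemma card_common_nbrs:
  assumes "u \<in> yoke_verts n m" "v \<in> yoke_verts n m"
  shows "card (nbrs (f u) \<inter> nbrs (f v)) = card (nbrs u \<inter> nbrs v)"
proof -
  have inj: "inj_on f (yoke_verts n m)" using bij by (rule bij_betw_imp_inj_on)
  have "f ` (nbrs u \<inter> nbrs v) = nbrs (f u) \<inter> nbrs (f v)"
    using assms inj_on_image_Int[OF inj nbrs_sub nbrs_sub] by (simp add: nbrs_image)
  then show ?thesis using card_image inj_on_subset[OF inj] nbrs_sub
    by (metis inf.coboundedI1)
qed

text \<open>Three corners of a 4-cycle are fixed. The image of the fourth is adjacent to both middle
  corners and, by injectivity, is not the opposite corner, so uniqueness of the square makes it the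
  fourth corner itself.\<close>

lemma fix_by_square:
  assumes nm: "(m + 1) * n > 4" and m: "m \<ge> 2" and ij: "i \<le> m" "j \<le> m" "i \<noteq> j"
    and e: "e \<in> {1, -1}" "e' \<in> {1, -1}"
    and s: "path s" "path (bump s i e)" "path (bump s j e')" "path (bump (bump s i e) j e')"
    and fx: "f (vert (bump s i e)) = vert (bump s i e)" "f (vert (bump s j e')) = vert (bump s j e')"
      "f (vert (bump (bump s i e) j e')) = vert (bump (bump s i e) j e')"
  shows "f (vert s) = vert s"
proof -
  \<comment> \<open>Uniqueness is applied from the opposite corner \<open>?z\<close>, where both
    moves are reversed and lead back to \<open>s\<close>.\<close>
  let ?z = "bump (bump s i e) j e'"
  have z: "bump ?z j (- e') = bump s i e" "bump ?z i (- e) = bump s j e'"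
    "bump (bump ?z j (- e')) i (- e) = s"
    using ij by (auto simp: bump_def)
  have V: "vert s \<in> yoke_verts n m" "vert ?z \<in> yoke_verts n m"
    using s vert_in_iff by auto
  have e': "- e \<in> {1, -1}" "- e' \<in> {1, -1}" using e by auto
  have "vert s \<in> nbrs (vert (bump s i e))" "vert s \<in> nbrs (vert (bump s j e'))"
    using s ij e by (auto simp: nbrs_def adj_sym[of "vert s"] adj_vert)
  then have nb: "f (vert s) \<in> nbrs (vert (bump s i e))" "f (vert s) \<in> nbrs (vert (bump s j e'))"
    using nbrs_image s vert_in_iff fx by (metis image_eqI)+
  have "e \<noteq> 0" using e by auto
  have "f (vert s) \<noteq> vert ?z"
    using vert_bump2_neq[OF m ij(1,3) \<open>e \<noteq> 0\<close>] f_inj[OF V] fx by metis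
  then show ?thesis
    using square(2)[OF nm ij(2,1) ij(3)[symmetric] e'(2,1), of ?z "f (vert s)"] s nb z by simp
qed

end

locale yoke_based_automorphism = yoke_automorphism +
  assumes m2: "m \<noteq> 2" and nm13: "(n, m) \<noteq> (1, 3)"
    and fix0: "f (vert base) = vert base"
    and fixb: "f (vert (bump base 0 (- 1))) = vert (bump base 0 (- 1))"
    and fixc: "f (vert (bump base m 1)) = vert (bump base m 1)"
begin

text \<open>For \<open>n = 1\<close> the excluded value leaves \<open>m + 1 \<ge> 5\<close>; for
  \<open>n \<ge> 2\<close> the product is at least 8.\<close>

lemma nm: "m \<ge> 3 \<Longrightarrow> (m + 1) * n > 4"
proof -
  assume m: "m \<ge> 3"
  show ?thesis
  proof (cases "n = 1")
    case True then show ?thesis using m nm13 by simp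
  next
    case False
    then have "2 \<le> n" using n_pos by simp
    then have "4 * 2 \<le> (m + 1) * n" using m by (intro mult_mono) auto
    then show ?thesis by simp
  qed
qed

text \<open>A lowering needs a flat step after its index and a rise before it, so two lowerings are
  never adjacent. They commute, and the other three corners of their square are closer to
  zero.\<close>

lemma fix_two_down:
  assumes IH: "\<And>t. near t \<Longrightarrow> dist0 t < dist0 s \<Longrightarrow> f (vert t) = vert t"
    and s: "near s" and ij: "i \<le> m" "j \<le> m" "i \<noteq> j"
    and d: "path (bump s i (- 1))" "path (bump s j (- 1))" "s i \<ge> 1" "s j \<ge> 1"
  shows "f (vert s) = vert s"
proof -
  have p: "path s" using s near_def by simp
  have adjacent: "i \<noteq> Suc j" "j \<noteq> Suc i"
    using d(1,2) ij p by (auto simp: path_bump_down)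
  \<comment> \<open>Two distinct non-adjacent indices require \<open>m \<ge> 2\<close>, and 2 is
    excluded.\<close>
  then have m3: "m \<ge> 3" using ij m2 by linarith
  have pz: "path (bump (bump s i (- 1)) j (- 1))"
    using path_bump_bump[OF d(1,2) p ij(3)] adjacent by auto
  have "near (bump s i (- 1))" "near (bump s j (- 1))" "near (bump (bump s i (- 1)) j (- 1))"
    using s d pz ij by (auto simp: near_def bump_def)
  moreover have "dist0 (bump s i (- 1)) < dist0 s" "dist0 (bump s j (- 1)) < dist0 s"
    "dist0 (bump (bump s i (- 1)) j (- 1)) < dist0 s"
    using ij d by (auto simp: dist0_bump) (auto simp: bump_def)
  ultimately show ?thesis
    using fix_by_square[OF nm[OF m3] _ ij _ _ p d(1,2) pz] IH m3 by auto
qed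

text \<open>Raising index 0 from \<open>-1\<close> and lowering the start \<open>j\<close> of the
  last plateau both decrease the distance. Since \<open>s 1 = 0\<close> and the plateau is positive,
  \<open>j \<ge> 2\<close> and the moves commute.\<close>

lemma fix_negative:
  assumes IH: "\<And>t. near t \<Longrightarrow> dist0 t < dist0 s \<Longrightarrow> f (vert t) = vert t"
    and s: "near s" "s 0 = -1" "s m \<ge> 1"
  shows "f (vert s) = vert s"
proof -
  have p: "path s" using s near_def by simp
  obtain j where j: "j \<le> m" "s j = s m" "path (bump s j (- 1))"
    using down_exists[OF p, of m] by auto
  have "m \<noteq> 0" using s by (cases m) auto
  have "s 1 \<ge> 0" using s \<open>m \<noteq> 0\<close> by (simp add: near_def)
  then have "s 1 = 0" using path_step[OF p, of 0] s \<open>m \<noteq> 0\<close> by auto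
  have j0: "j \<noteq> 0" by (rule notI) (use s j in auto)
  have j1: "j \<noteq> Suc 0" by (rule notI) (use s j \<open>s 1 = 0\<close> in auto)
  have m3: "m \<ge> 3" using j0 j1 j m2 by linarith
  have p0: "path (bump s 0 1)" using path_bump_up[OF p, of 0] s \<open>s 1 = 0\<close> by auto
  have pz: "path (bump (bump s j (- 1)) 0 1)"
    using path_bump_bump[OF j(3) p0 p] j0 j1 by auto
  have "near (bump s 0 1)" "near (bump s j (- 1))" "near (bump (bump s j (- 1)) 0 1)"
    using s j pz p0 j0 by (auto simp: near_def bump_def)
  moreover have "dist0 (bump s 0 1) < dist0 s" "dist0 (bump s j (- 1)) < dist0 s"
    "dist0 (bump (bump s j (- 1)) 0 1) < dist0 s"
    using j s j0 by (auto simp: dist0_bump) (auto simp: bump_def)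
  ultimately show ?thesis
    using fix_by_square[OF nm[OF m3] _ j(1) _ j0 _ _ p j(3) p0 pz] IH m3 by auto
qed

lemma fix_trivial:
  assumes s: "near s" "s m \<le> 0"
  shows "f (vert s) = vert s"
proof -
  have p: "path s" using s near_def by simp
  have z: "s k = 0" if "k \<le> m" "k > 0" for k
    using path_mono[OF p, of k m] that s by (force simp: near_def)
  have "s 0 = 0 \<or> s 0 = -1" using path_mono[OF p, of 0 m] s by (auto simp: near_def)
  then show ?thesis
  proof
    assume "s 0 = 0"
    then have "vert s = vert base" using z by (intro vert_eqI[where c = 0]) (force simp: base_def)
    then show ?thesis using fix0 by simp
  next
    assume "s 0 = -1"
    then have "vert s = vert (bump base 0 (- 1))"
      using z by (intro vert_eqI[where c = 0]) (auto simp: base_def bump_def)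
    then show ?thesis using fixb by simp
  qed
qed

end

section \<open>The exceptional pair of vertices\<close>

context yoke begin

text \<open>The height function singled out by \<open>common_lower_cover\<close>; raising it at
  \<open>m - 2\<close> and raising it at \<open>m\<close> give the pair that needs a separate
  invariant.\<close>

definition fork :: "nat \<Rightarrow> int" where "fork = (\<lambda>k. if k \<ge> m - 1 then 1 else 0)"

lemma path_fork:
  assumes "m \<ge> 3"
  shows "path fork" "path (bump fork (m - 2) 1)" "path (bump fork m 1)" "path (bump fork 0 (- 1))"
proof -
  have f: "Suc (m - 2) = m - 1" "\<not> m - 1 \<le> m - 2" "\<not> m - 1 \<le> m - 3" "0 < m - 1" "1 < m - 1"
    "m - 2 - 1 = m - 3" "m - 1 \<le> m" using assms by auto
  show p: "path fork" by (auto simp: path_def fork_def)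
  show "path (bump fork (m - 2) 1)" "path (bump fork m 1)" "path (bump fork 0 (- 1))"
    using path_bump_up[OF p, of "m - 2"] path_bump_up[OF p, of m] path_bump_down[OF p, of 0] f
    by (simp_all add: fork_def)
qed

text \<open>After raising at \<open>m\<close> only the indices 0, \<open>m - 2\<close> and
  \<open>m\<close> can move. After raising at \<open>m - 2\<close> the indices 0,
  \<open>m - 3\<close>, \<open>m - 2\<close> and \<open>m\<close> can, and \<open>m \<ge> 4\<close>
  makes these four distinct.\<close>

lemma card_nbrs_fork:
  assumes "m \<ge> 4"
  shows "card (nbrs (vert (bump fork m 1))) < card (nbrs (vert (bump fork (m - 2) 1)))"
proof -
  let ?s = "bump fork m 1" and ?t = "bump fork (m - 2) 1"
  have p: "path ?s" "path ?t" using path_fork assms by auto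
  have *: "i = 0 \<and> e = -1 \<or> i = m - 2 \<and> e = 1 \<or> i = m \<and> e = -1"
    if "path (bump ?s i e)" "i \<le> m" "e \<in> {1, -1}" for i e
  proof -
    from that(3) consider "e = 1" | "e = -1" by auto
    then show ?thesis
    proof cases
      case 1
      then have "(i = 0 \<or> ?s (i - 1) = ?s i) \<and> (i = m \<or> ?s i < ?s (Suc i))"
        using that path_bump_up[OF p(1)] by auto
      then show ?thesis using 1 that(2) assms by (auto simp: bump_def fork_def split: if_splits)
    next
      case 2
      then have "(i = 0 \<or> ?s (i - 1) < ?s i) \<and> (i = m \<or> ?s (Suc i) = ?s i)"
        using that path_bump_down[OF p(1)] by auto
      then show ?thesis using 2 that(2) assms by (auto simp: bump_def fork_def split: if_splits)
    qed
  qed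
  have "nbrs (vert ?s) \<subseteq> {vert (bump ?s 0 (- 1)), vert (bump ?s (m - 2) 1), vert (bump ?s m (- 1))}"
  proof (rule nbrs_subsetI[OF p(1)])
    fix i e assume "i \<le> m" "e \<in> {1, - 1 :: int}" "path (bump ?s i e)"
    then show "vert (bump ?s i e)
        \<in> {vert (bump ?s 0 (- 1)), vert (bump ?s (m - 2) 1), vert (bump ?s m (- 1))}"
      using *[of i e] by auto
  qed
  then have "card (nbrs (vert ?s)) \<le> card {vert (bump ?s 0 (- 1)), vert (bump ?s (m - 2) 1), vert (bump ?s m (- 1))}"
    by (intro card_mono) auto
  also have "\<dots> \<le> 3" by (auto simp: card_insert_if)
  finally have 1: "card (nbrs (vert ?s)) \<le> 3" .
  have t: "path (bump ?t (m - 2) (- 1))" using path_fork(1) assms by simp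
  have "m - 3 \<noteq> m - 2" "Suc (m - 3) = m - 2" "m - 4 \<noteq> m - 2"
    "\<not> m - 1 \<le> m - 4" "\<not> m - 1 \<le> m - 3" "\<not> m - 1 \<le> m - 2" using assms by auto
  then have t': "path (bump ?t (m - 3) 1)"
    using path_bump_up[OF p(2), of "m - 3"] assms by (simp add: bump_def fork_def)
  have "\<not> m - Suc 0 \<le> Suc 0" "Suc 0 \<noteq> m - 2" "m \<noteq> m - 2" "m - 1 \<noteq> m - 2" using assms by auto
  then have "path (bump ?t m 1)" "path (bump ?t 0 (- 1))"
    using path_bump_up[OF p(2), of m] path_bump_down[OF p(2), of 0] assms
    by (simp_all add: bump_def fork_def)
  with t t' have "\<exists>e\<in>{1, -1}. path (bump ?t i e)" if "i \<in> {0, m - 3, m - 2, m}" for i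
    using that by auto
  then have "card {0, m - 3, m - 2, m} \<le> card (nbrs (vert ?t))"
    using assms by (intro card_nbrs_ge p) auto
  moreover have "card {0, m - 3, m - 2, m} = 4"
  proof -
    have "m - 3 \<noteq> 0" "m - 2 \<noteq> 0" "m \<noteq> 0" "m - 3 \<noteq> m - 2" "m - 3 \<noteq> m" "m - 2 \<noteq> m"
      using assms by auto
    then show ?thesis by (simp add: card_insert_if)
  qed
  ultimately show ?thesis using 1 by linarith
qed

text \<open>For \<open>m = 3\<close> both vertices have degree 3, so they are compared through a
  third vertex, the fork lowered at 0. That lowering commutes with raising at \<open>m\<close>,
  which yields a common neighbour besides the fork; with raising at \<open>m - 2 = 1\<close> it
  would create a step of 2.\<close>

lemma card_common_nbrs_fork:
  assumes "m = 3" "(m + 1) * n > 4"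
  shows "card (nbrs (vert (bump fork (m - 2) 1)) \<inter> nbrs (vert (bump fork 0 (- 1))))
    < card (nbrs (vert (bump fork m 1)) \<inter> nbrs (vert (bump fork 0 (- 1))))"
proof -
  have m: "m \<ge> 3" using assms by simp
  note p = path_fork[OF m]
  let ?x = "bump fork 0 (- 1)"
  have "nbrs (vert (bump fork (m - 2) 1)) \<inter> nbrs (vert ?x) \<subseteq> {vert fork}"
  proof (rule subsetI, rule ccontr)
    fix y assume y: "y \<in> nbrs (vert (bump fork (m - 2) 1)) \<inter> nbrs (vert ?x)" "y \<notin> {vert fork}"
    then have "path (bump (bump fork (m - 2) 1) 0 (- 1))"
      using square(1)[OF assms(2) _ _ _ _ _ p(2,4), of y] m by auto
    then show False using path_step[of "bump (bump fork (m - 2) 1) 0 (- 1)" 0] assms(1)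
      unfolding bump_def fork_def by simp
  qed
  then have 1: "card (nbrs (vert (bump fork (m - 2) 1)) \<inter> nbrs (vert ?x)) \<le> 1"
    using card_mono[of "{vert fork}"] by fastforce
  let ?u = "bump (bump fork m 1) 0 (- 1)"
  have u: "?u = bump ?x m 1" "bump (bump fork m 1) m (- 1) = fork" "bump ?x 0 1 = fork"
    using m by (auto simp: bump_def)
  have pu: "path ?u" by (rule path_bump_bump) (use p m in auto)
  have "{vert fork, vert ?u} \<subseteq> nbrs (vert (bump fork m 1)) \<inter> nbrs (vert ?x)"
    unfolding mem_nbrs_vert[OF p(3)] mem_nbrs_vert[OF p(4)] subset_iff Int_iff
    using u pu p by (metis empty_iff insertE insertI1 insertI2 le0 le_refl)
  moreover have "vert ?u \<noteq> vert fork" using vert_bump2_neq[of m 0 1 fork "-1"] m by simp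
  then have "card {vert fork, vert ?u} = 2" by simp
  moreover have "finite (nbrs (vert (bump fork m 1)))" using finite_nbrs vert_in_iff p by auto
  ultimately have "2 \<le> card (nbrs (vert (bump fork m 1)) \<inter> nbrs (vert ?x))"
    by (metis card_mono finite_Int)
  then show ?thesis using 1 by linarith
qed

lemma dist0_cong: "(\<And>k. k \<le> m \<Longrightarrow> s k = t k) \<Longrightarrow> dist0 s = dist0 t"
  by (simp add: dist0_def)

lemma path_cong: "(\<And>k. k \<le> m \<Longrightarrow> s k = t k) \<Longrightarrow> path s = path t"
  by (simp add: path_def)

lemma vert_cong: "(\<And>k. k \<le> m \<Longrightarrow> s k = t k) \<Longrightarrow> vert s = vert t"
  by (rule vert_eqI[where c = 0]) simp

end

section \<open>Induction on the distance to zero\<close>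

context yoke_based_automorphism begin

text \<open>Automorphisms preserve degrees and numbers of common neighbours. The set equation covers
  both orders, since the induction may reach either vertex of the pair.\<close>

lemma fork_separated:
  assumes m: "m \<ge> 3" and x: "f (vert (bump fork 0 (- 1))) = vert (bump fork 0 (- 1))"
    and i: "{i, k} = {m - 2, m}"
  shows "f (vert (bump fork i 1)) \<noteq> vert (bump fork k 1)"
proof
  assume eq: "f (vert (bump fork i 1)) = vert (bump fork k 1)"
  have V: "vert (bump fork (m - 2) 1) \<in> yoke_verts n m" "vert (bump fork m 1) \<in> yoke_verts n m"
    "vert (bump fork 0 (- 1)) \<in> yoke_verts n m"
    using path_fork[OF m] vert_in_iff by auto
  have ik: "i = m - 2 \<and> k = m \<or> i = m \<and> k = m - 2" using i by (auto simp: doubleton_eq_iff)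
  show False
  proof (cases "m = 3")
    case True
    show False using card_common_nbrs_fork[OF True nm[OF m]] ik eq
      card_common_nbrs[OF V(1,3)] card_common_nbrs[OF V(2,3)] x by auto
  next
    case False
    then have "m \<ge> 4" using m by simp
    then show False using card_nbrs_fork ik eq card_nbrs[OF V(1)] card_nbrs[OF V(2)] by auto
  qed
qed

lemma near_fixed: "near s \<Longrightarrow> f (vert s) = vert s"
proof (induction "nat (dist0 s)" arbitrary: s rule: less_induct)
  case less
  have IH: "f (vert t) = vert t" if "near t" "dist0 t < dist0 s" for t
    using less.hyps that dist0_nonneg[of t] by (simp add: nat_less_eq_zless)
  have ns: "near s" by fact
  then have p: "path s" by (simp add: near_def)
  consider "s m \<le> 0" | "s m \<ge> 1" "s 0 = -1" | "s m \<ge> 1" "s 0 \<ge> 0"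
    using ns unfolding near_def by linarith
  then show ?case
  proof cases
    case 1 then show ?thesis using fix_trivial ns by blast
  next
    case 2 then show ?thesis using fix_negative IH ns by blast
  next
    case 3
    have s_nonneg: "s j \<ge> 0" if "j \<le> m" for j
      using 3(2) ns that by (cases "j = 0") (auto simp: near_def)
    \<comment> \<open>Lowering the start of the last plateau gives a vertex \<open>w\<close> that is
      closer to zero, hence fixed; so \<open>f\<close> sends \<open>s\<close> to some neighbour
      \<open>t\<close> of \<open>w\<close>.\<close>
    obtain i where i: "i \<le> m" "s i = s m" "path (bump s i (- 1))"
      using down_exists[OF p, of m] by auto
    define w where "w = bump s i (- 1)"
    have sw: "s = bump w i 1" unfolding w_def by simp
    have pw: "path w" using i w_def by simp
    have w_nonneg: "w j \<ge> 0" if "j \<le> m" for j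
      using s_nonneg[OF that] i 3 by (auto simp: w_def bump_def)
    have nw: "near w" using pw w_nonneg w_def by (force simp: near_def)
    have dw: "dist0 w = dist0 s - 1" unfolding w_def using i 3 by (simp add: dist0_bump)
    have fw: "f (vert w) = vert w" using IH[OF nw] dw by simp
    have Vs: "vert s \<in> yoke_verts n m" using p vert_in_iff by simp
    have Vw: "vert w \<in> yoke_verts n m" using pw vert_in_iff by simp
    have "vert s \<in> nbrs (vert w)" using mem_nbrs_vert[OF pw] sw i p by auto
    then have "f (vert s) \<in> nbrs (vert w)" using nbrs_image[OF Vw] fw by auto
    then obtain k e where k: "k \<le> m" "e \<in> {1, -1}" "path (bump w k e)" "f (vert s) = vert (bump w k e)"
      using mem_nbrs_vert[OF pw] by blast
    define t where "t = bump w k e"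
    have pt: "path t" "f (vert s) = vert t" using k t_def by auto
    \<comment> \<open>If the image of \<open>vert s\<close> is itself fixed, injectivity forces it
      to be \<open>vert s\<close>.\<close>
    have fixed: ?thesis if "f (vert t) = vert t"
      using f_inj[OF Vs, of "vert t"] that pt vert_in_iff by metis
    show ?thesis
    proof (cases "e = -1")
      case True
      show ?thesis
      proof (cases "w k \<ge> 1")
        case True
        have "near t" using pt(1) w_nonneg True \<open>e = -1\<close> k(1) unfolding near_def t_def
          by (force simp: bump_def)
        moreover have "dist0 t < dist0 s"
          using dw True \<open>e = -1\<close> k(1) by (simp add: t_def dist0_bump)
        ultimately show ?thesis using IH fixed by blast
      next
        case False
        then have wk: "w k = 0" using w_nonneg[OF k(1)] by simp
        have "k = 0"
        proof (rule ccontr)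
          assume "k \<noteq> 0"
          then have "w (k - 1) < 0" using k(3) \<open>e = -1\<close> path_bump_down[OF pw k(1)] wk by auto
          then show False using w_nonneg[of "k - 1"] k(1) by linarith
        qed
        \<comment> \<open>This \<open>t\<close> is as far from zero as \<open>s\<close>, so the
          induction hypothesis does not reach it; its height \<open>-1\<close> at index 0 puts it
          under the cases settled separately.\<close>
        have nt: "near t" using pt(1) w_nonneg \<open>e = -1\<close> \<open>k = 0\<close> wk unfolding near_def t_def
          by (force simp: bump_def)
        have dt: "dist0 t = dist0 s"
          using dw \<open>e = -1\<close> k(1) wk by (simp add: t_def dist0_bump)
        have IHt: "f (vert u) = vert u" if "near u" "dist0 u < dist0 t" for u
          using IH that dt by simp
        have "t 0 = -1" using wk \<open>e = -1\<close> \<open>k = 0\<close> by (simp add: t_def bump_def)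
        then have "f (vert t) = vert t"
          using fix_trivial[OF nt] fix_negative[OF IHt nt] by (cases "t m \<le> 0") auto
        then show ?thesis by (rule fixed)
      qed
    next
      case False
      then have e: "e = 1" using k by simp
      have nt: "near t" using pt(1) w_nonneg e unfolding near_def t_def by (force simp: bump_def)
      have dt: "dist0 t = dist0 s"
        using dw e k(1) w_nonneg[OF k(1)] by (simp add: t_def dist0_bump)
      have IHt: "f (vert u) = vert u" if "near u" "dist0 u < dist0 t" for u
        using IH that dt by simp
      have tk: "path (bump t k (- 1))" "t k \<ge> 1"
        using pw e w_nonneg[OF k(1)] by (auto simp: t_def) (simp add: bump_def)
      show ?thesis
      proof (rule ccontr)
        assume neq: "f (vert s) \<noteq> vert s"
        have "i \<noteq> k" using neq pt(2) sw t_def e by auto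
        \<comment> \<open>A second lowering would make \<open>s\<close> fixed by a square; a second
          lowering of \<open>t\<close> would make \<open>t\<close>, and thereby \<open>s\<close>,
          fixed.\<close>
        have us: "j = i" if "j \<le> m" "path (bump (bump w i 1) j (- 1))" "bump w i 1 j \<ge> 1" for j
          using fix_two_down[OF IH ns i(1) that(1) _ i(3)] that sw neq 3 i by auto
        have ut: "j = k" if "j \<le> m" "path (bump (bump w k 1) j (- 1))" "bump w k 1 j \<ge> 1" for j
          using fix_two_down[OF IHt nt k(1) that(1) _ tk(1) _ tk(2)] that fixed neq e
          unfolding t_def by auto
        have pik: "path (bump w i 1)" "path (bump w k 1)" using p sw pt t_def e by auto
        have "m \<ge> 3 \<and> {i, k} = {m - 2, m} \<and> (\<forall>p\<le>m. w p = fork p)"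
        proof (cases "i < k")
          case True
          then show ?thesis
            using common_lower_cover[OF pw w_nonneg True k(1) m2 pik us ut] by (auto simp: fork_def)
        next
          case False
          then have "k < i" using \<open>i \<noteq> k\<close> by simp
          then show ?thesis
            using common_lower_cover[OF pw w_nonneg _ i(1) m2 pik(2,1) ut us] by (auto simp: fork_def)
        qed
        then have m3: "m \<ge> 3" and ik: "{i, k} = {m - 2, m}" and wf: "\<And>p. p \<le> m \<Longrightarrow> w p = fork p"
          by auto
        have vb: "vert (bump w j a) = vert (bump fork j a)" for j a
          by (rule vert_cong) (use wf in \<open>auto simp: bump_def\<close>)
        \<comment> \<open>Also \<open>?x\<close> has the distance of \<open>s\<close>, but its
          height \<open>-1\<close> at 0 lets the square argument fix it from closer
          vertices.\<close>
        let ?x = "bump fork 0 (- 1)"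
        have nx: "near ?x" using path_fork[OF m3] m3 by (auto simp: near_def bump_def fork_def)
        have "dist0 ?x = dist0 fork + 1" using m3 by (simp add: dist0_bump) (simp add: fork_def)
        also have "dist0 fork = dist0 w" by (rule dist0_cong) (simp add: wf)
        finally have dx: "dist0 ?x = dist0 s" using dw by simp
        have "?x 0 = -1" "?x m \<ge> 1" using m3 by (auto simp: bump_def fork_def)
        moreover have "f (vert u) = vert u" if "near u" "dist0 u < dist0 ?x" for u
          using IH that dx by simp
        ultimately have "f (vert ?x) = vert ?x" using fix_negative nx by blast
        then have "f (vert (bump fork i 1)) \<noteq> vert (bump fork k 1)"
          by (rule fork_separated[OF m3 _ ik])
        then show False using pt(2) sw t_def e vb by metis
      qed
    qed
  qed
qed

lemma fixed: "v \<in> yoke_verts n m \<Longrightarrow> f v = v"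
proof -
  assume "v \<in> yoke_verts n m"
  then obtain s where s: "path s" "\<And>k. k \<le> m \<Longrightarrow> s k \<ge> 0" "v = vert s" using vert_surj by metis
  then have "near s" by (force simp: near_def)
  then show ?thesis using near_fixed s by simp
qed

end
section \<open>The generated subgroup\<close>

lemma carrier_yoke_aut: "f \<in> carrier (yoke_aut n m) \<longleftrightarrow> f \<in> Bij (yoke_verts n m) \<and>
    (\<forall>u \<in> yoke_verts n m. \<forall>v \<in> yoke_verts n m.
       yoke_adj n m u v \<longleftrightarrow> yoke_adj n m (f u) (f v))"
  by (simp add: yoke_aut_def)

lemma one_yoke_aut: "\<one>\<^bsub>yoke_aut n m\<^esub> = (\<lambda>v\<in>yoke_verts n m. v)"
  by (simp add: yoke_aut_def BijGroup_def)

lemma mult_yoke_aut: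
  assumes "f \<in> carrier (yoke_aut n m)" "g \<in> carrier (yoke_aut n m)"
  shows "f \<otimes>\<^bsub>yoke_aut n m\<^esub> g = compose (yoke_verts n m) f g"
  using assms by (simp add: yoke_aut_def BijGroup_def)

lemma group_yoke_aut: "group (yoke_aut n m)"
proof -
  let ?V = "yoke_verts n m" and ?C = "carrier (yoke_aut n m)"
  interpret B: group "BijGroup ?V" by (rule group_BijGroup)
  have in_V: "f u \<in> ?V" if "f \<in> Bij ?V" "u \<in> ?V" for f u
    using that by (auto simp: Bij_def bij_betw_def)
  have "subgroup ?C (BijGroup ?V)"
  proof (rule B.subgroupI)
    show "?C \<subseteq> carrier (BijGroup ?V)" by (auto simp: carrier_yoke_aut BijGroup_def)
    have "(\<lambda>v\<in>?V. v) \<in> ?C" by (simp add: carrier_yoke_aut id_Bij)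
    then show "?C \<noteq> {}" by blast
  next
    fix f assume f: "f \<in> ?C"
    then have fB: "f \<in> Bij ?V" by (simp add: carrier_yoke_aut)
    let ?g = "\<lambda>v\<in>?V. inv_into ?V f v"
    have g: "?g \<in> Bij ?V" using fB by (rule restrict_inv_into_Bij)
    have "?g \<otimes>\<^bsub>BijGroup ?V\<^esub> f = \<one>\<^bsub>BijGroup ?V\<^esub>"
      using fB g by (simp add: BijGroup_def Bij_compose_restrict_eq)
    then have inv: "inv\<^bsub>BijGroup ?V\<^esub> f = ?g"
      using fB g by (intro B.inv_equality) (auto simp: BijGroup_def)
    have fg: "f (?g u) = u" if "u \<in> ?V" for u
      using fB that bij_betw_inv_into_right[of f ?V ?V u] by (simp add: Bij_def)
    have "yoke_adj n m u v \<longleftrightarrow> yoke_adj n m (?g u) (?g v)" if "u \<in> ?V" "v \<in> ?V" for u v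
    proof -
      have "?g u \<in> ?V" "?g v \<in> ?V" using in_V[OF g] that by blast+
      then have "yoke_adj n m (?g u) (?g v) \<longleftrightarrow> yoke_adj n m (f (?g u)) (f (?g v))"
        using f unfolding carrier_yoke_aut by blast
      then show ?thesis using fg that by simp
    qed
    then show "inv\<^bsub>BijGroup ?V\<^esub> f \<in> ?C" unfolding inv carrier_yoke_aut using g by blast
  next
    fix f g assume fg: "f \<in> ?C" "g \<in> ?C"
    then have B: "f \<in> Bij ?V" "g \<in> Bij ?V" by (auto simp: carrier_yoke_aut)
    then have "f \<otimes>\<^bsub>BijGroup ?V\<^esub> g = compose ?V f g" by (simp add: BijGroup_def)
    moreover have "compose ?V f g \<in> ?C"
      using fg in_V[OF B(2)] compose_Bij[OF B] by (simp add: carrier_yoke_aut compose_eq)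
    ultimately show "f \<otimes>\<^bsub>BijGroup ?V\<^esub> g \<in> ?C" by simp
  qed
  then have "group (BijGroup ?V \<lparr>carrier := ?C\<rparr>)"
    by (rule subgroup.subgroup_is_group) (rule group_BijGroup)
  then show ?thesis by (simp add: yoke_aut_def)
qed

section \<open>Symmetries described on height functions\<close>

context yoke begin

text \<open>The last conjunct says that \<open>T\<close> turns a single move into a single move,
  which is what makes \<open>f\<close> preserve adjacency.\<close>

definition lifts :: "(int list \<Rightarrow> int list) \<Rightarrow> ((nat \<Rightarrow> int) \<Rightarrow> nat \<Rightarrow> int) \<Rightarrow> bool" where
  "lifts f T \<longleftrightarrow> f \<in> extensional (yoke_verts n m)
    \<and> (\<forall>s. path s \<longrightarrow> path (T s) \<and> f (vert s) = vert (T s))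
    \<and> (\<forall>s i e. i \<le> m \<longrightarrow> e \<in> {1, -1} \<longrightarrow>
         (\<exists>i'\<le>m. \<exists>e'\<in>{1, -1}. \<forall>k\<le>m. T (bump s i e) k = bump (T s) i' e' k))"

lemma lifts_vert: "lifts f T \<Longrightarrow> path s \<Longrightarrow> f (vert s) = vert (T s)"
  by (simp add: lifts_def)

lemma lifts_in: "lifts f T \<Longrightarrow> v \<in> yoke_verts n m \<Longrightarrow> f v \<in> yoke_verts n m"
  by (metis lifts_def vert_in_iff vert_surj)

lemma lifts_adj:
  assumes "lifts f T" "yoke_adj n m u v"
  shows "yoke_adj n m (f u) (f v)"
proof -
  have "v \<in> yoke_verts n m" using assms(2) by (simp add: yoke_adj_def)
  then obtain s where s: "path s" "v = vert s" by (rule vert_surj)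
  then obtain i e where i: "i \<le> m" "e \<in> {1, -1}" "path (bump s i e)" "u = vert (bump s i e)"
    using assms(2) adj_vert by blast
  obtain i' e' where i': "i' \<le> m" "e' \<in> {1, -1}" "\<And>k. k \<le> m \<Longrightarrow> T (bump s i e) k = bump (T s) i' e' k"
    using assms(1) i(1,2) unfolding lifts_def by meson
  have "path (T s)" "path (T (bump s i e))" "f v = vert (T s)" "f u = vert (T (bump s i e))"
    using assms(1) s i by (auto simp: lifts_def)
  moreover have "path (T (bump s i e)) = path (bump (T s) i' e')"
    "vert (T (bump s i e)) = vert (bump (T s) i' e')"
    using i'(3) path_cong vert_cong by blast+
  ultimately show ?thesis using vert_bump_in_nbrs[of "T s" i' e'] i' by (simp add: nbrs_def)
qed

text \<open>Mutually inverse maps of heights descend to mutually inverse maps of vertices; the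
  inverse supplies both bijectivity and the reflection of adjacency.\<close>

lemma lifts_aut:
  assumes "lifts f T" "lifts g S"
    and "\<And>s k. path s \<Longrightarrow> k \<le> m \<Longrightarrow> T (S s) k = s k" "\<And>s k. path s \<Longrightarrow> k \<le> m \<Longrightarrow> S (T s) k = s k"
  shows "f \<in> carrier (yoke_aut n m)"
proof -
  have fg: "f (g v) = v" "g (f v) = v" if v: "v \<in> yoke_verts n m" for v
  proof -
    obtain s where s: "path s" "v = vert s" using vert_surj[OF v] by blast
    then have "path (T s)" "path (S s)" using assms(1,2) by (auto simp: lifts_def)
    then have "f (g v) = vert (T (S s))" "g (f v) = vert (S (T s))"
      using s assms(1,2) by (auto simp: lifts_vert)
    then show "f (g v) = v" "g (f v) = v" using s assms(3,4) vert_cong by metis+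
  qed
  have "bij_betw f (yoke_verts n m) (yoke_verts n m)"
    using fg lifts_in[OF assms(1)] lifts_in[OF assms(2)]
    by (intro bij_betw_byWitness[where f' = g]) auto
  moreover have "yoke_adj n m u v \<longleftrightarrow> yoke_adj n m (f u) (f v)"
    if "u \<in> yoke_verts n m" "v \<in> yoke_verts n m" for u v
    using lifts_adj[OF assms(1)] lifts_adj[OF assms(2)] fg that by metis
  ultimately show ?thesis using assms(1) by (simp add: carrier_yoke_aut Bij_def lifts_def)
qed

text \<open>An arbitrary shift is allowed so that the inverse of \<open>yoke_phi\<close> has the
  same form.\<close>

definition translate :: "int \<Rightarrow> int list \<Rightarrow> int list" where
  "translate c = (\<lambda>v \<in> yoke_verts n m.
     v[0 := (v ! 0 + c) mod int n, m + 1 := (v ! (m+1) - c) mod int n])"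

lemma yoke_phi_translate: "yoke_phi n m = translate 1"
  by (simp add: yoke_phi_def translate_def)

lemma lifts_translate: "lifts (translate c) (\<lambda>s k. s k + c)"
  unfolding lifts_def
proof (intro conjI allI impI)
  fix s assume p: "path s"
  then show "path (\<lambda>k. s k + c)" by (simp add: path_def)
  have "vert s \<in> yoke_verts n m" using p vert_in_iff by simp
  moreover have "(vert s)[0 := (vert s ! 0 + c) mod int n, m + 1 := (vert s ! (m+1) - c) mod int n]
      = vert (\<lambda>k. s k + c)"
  proof (rule nth_equalityI)
    fix i assume "i < length ((vert s)[0 := (vert s ! 0 + c) mod int n, m + 1 := (vert s ! (m+1) - c) mod int n])"
    then have i: "i < m + 2" by simp
    have "(- s m - c) mod int n = (- (s m + c)) mod int n" by simp
    then show "(vert s)[0 := (vert s ! 0 + c) mod int n, m + 1 := (vert s ! (m+1) - c) mod int n] ! i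
        = vert (\<lambda>k. s k + c) ! i"
      using i by (auto simp: vert_nth nth_list_update mod_add_left_eq mod_diff_left_eq)
  qed simp
  ultimately show "translate c (vert s) = vert (\<lambda>k. s k + c)" by (simp add: translate_def)
next
  fix s :: "nat \<Rightarrow> int" and i and e :: int
  assume "i \<le> m" "e \<in> {1, -1}"
  then show "\<exists>i'\<le>m. \<exists>e'\<in>{1, -1}. \<forall>k\<le>m. bump s i e k + c = bump (\<lambda>k. s k + c) i' e' k"
    by (intro exI[of _ i] conjI bexI[of _ e]) (auto simp: bump_def)
qed (simp add: translate_def)

text \<open>The total vanishes modulo \<open>n\<close>, so a partial sum taken from the right is
  minus the complementary one taken from the left.\<close>

lemma lifts_psi: "lifts (yoke_psi n m) (\<lambda>s k. - s (m - k))"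
  unfolding lifts_def
proof (intro conjI allI impI)
  fix s assume p: "path s"
  show "path (\<lambda>k. - s (m - k))" unfolding path_def
  proof (intro allI impI)
    fix k assume k: "k < m"
    then have "Suc (m - Suc k) = m - k" by simp
    then show "- s (m - Suc k) - - s (m - k) \<in> {0, 1}"
      using path_step[OF p, of "m - Suc k"] k by auto
  qed
  have "vert s \<in> yoke_verts n m" using p vert_in_iff by simp
  moreover have "rev (vert s) = vert (\<lambda>k. - s (m - k))"
  proof (rule nth_equalityI)
    fix i assume "i < length (rev (vert s))"
    then have i: "i < m + 2" by simp
    consider "i = 0" | "i = m + 1" | k where "i = Suc k" "k < m"
      using i by (cases "i = m + 1"; cases i) (auto simp: less_Suc_eq)
    then show "rev (vert s) ! i = vert (\<lambda>k. - s (m - k)) ! i"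
    proof cases
      case 3
      then have "Suc m - Suc k = Suc (m - Suc k)" "Suc (m - Suc k) = m - k" by auto
      then show ?thesis using 3 vert_nths(3)[of "m - Suc k" s] by (simp add: rev_nth vert_nths)
    qed (simp_all add: rev_nth vert_nths)
  qed simp
  ultimately show "yoke_psi n m (vert s) = vert (\<lambda>k. - s (m - k))" by (simp add: yoke_psi_def)
next
  fix s :: "nat \<Rightarrow> int" and i and e :: int
  assume "i \<le> m" "e \<in> {1, -1}"
  then show "\<exists>i'\<le>m. \<exists>e'\<in>{1, -1}. \<forall>k\<le>m.
      - bump s i e (m - k) = bump (\<lambda>k. - s (m - k)) i' e' k"
    by (intro exI[of _ "m - i"] conjI bexI[of _ "- e"]) (auto simp: bump_def)
qed (simp add: yoke_psi_def)

text \<open>Replacing every step by its complement replaces each height by its difference from the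
  path \<open>0, 1, ..., m\<close>.\<close>

lemma lifts_tau: "lifts (yoke_tau n m) (\<lambda>s k. int k - s k)"
  unfolding lifts_def
proof (intro conjI allI impI)
  fix s assume p: "path s"
  then show "path (\<lambda>k. int k - s k)" by (force simp: path_def)
  have "vert s \<in> yoke_verts n m" using p vert_in_iff by simp
  moreover have "map (\<lambda>i. if i = 0 then (- (vert s ! 0)) mod int n
              else if i = m + 1 then (- (int m + vert s ! (m+1))) mod int n
              else 1 - vert s ! i) [0..<m+2] = vert (\<lambda>k. int k - s k)" (is "?l = _")
  proof (rule nth_equalityI)
    fix i assume "i < length ?l"
    then have i: "i < m + 2" by simp
    then have "?l ! i = (if i = 0 then (- (vert s ! 0)) mod int n
              else if i = m + 1 then (- (int m + vert s ! (m+1))) mod int n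
              else 1 - vert s ! i)" by (subst nth_map) (simp_all del: upt_Suc)
    moreover have "(- (int m + (- s m) mod int n)) mod int n = (- (int m - s m)) mod int n"
    proof -
      have "(int m + (- s m) mod int n) mod int n = (int m - s m) mod int n"
        by (simp add: mod_add_right_eq)
      then show ?thesis using mod_minus_eq by metis
    qed
    moreover have "(- (s 0 mod int n)) mod int n = (- s 0) mod int n" by (rule mod_minus_eq)
    ultimately show "?l ! i = vert (\<lambda>k. int k - s k) ! i"
      using i by (auto simp: vert_nth of_nat_diff)
  qed simp
  ultimately show "yoke_tau n m (vert s) = vert (\<lambda>k. int k - s k)" by (simp add: yoke_tau_def)
next
  fix s :: "nat \<Rightarrow> int" and i and e :: int
  assume "i \<le> m" "e \<in> {1, -1}"
  then show "\<exists>i'\<le>m. \<exists>e'\<in>{1, -1}. \<forall>k\<le>m.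
      int k - bump s i e k = bump (\<lambda>k. int k - s k) i' e' k"
    by (intro exI[of _ i] conjI bexI[of _ "- e"]) (auto simp: bump_def)
qed (simp add: yoke_tau_def)

lemma generators_in_yoke_aut: "{yoke_phi n m, yoke_psi n m, yoke_tau n m} \<subseteq> carrier (yoke_aut n m)"
  using lifts_aut[OF lifts_translate[of 1] lifts_translate[of "- 1"]] lifts_aut[OF lifts_psi lifts_psi]
    lifts_aut[OF lifts_tau lifts_tau] yoke_phi_translate by auto

section \<open>Vertices of degree at most two\<close>

lemma path_bump_exists:
  assumes "path s" "i \<le> m" "m \<ge> 1" "i = 0 \<or> i = m \<or> s i - s (i - 1) \<noteq> s (Suc i) - s i"
  shows "\<exists>e\<in>{1, -1}. path (bump s i e)"
proof -
  have "path (bump s i 1) \<or> path (bump s i (- 1))"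
  proof (cases "i = 0")
    case True
    then show ?thesis using path_bump_up[OF assms(1,2)] path_bump_down[OF assms(1,2)]
      path_step[OF assms(1), of 0] assms(3) by force
  next
    case False
    then have "s i = s (i - 1) \<or> s i = s (i - 1) + 1" using path_pred[OF assms(1)] assms(2) by simp
    moreover have "i < m \<Longrightarrow> s (Suc i) = s i \<or> s (Suc i) = s i + 1" using path_step[OF assms(1)] by simp
    ultimately show ?thesis using path_bump_up[OF assms(1,2)] path_bump_down[OF assms(1,2)]
      assms(2,4) False by (cases "i = m") force+
  qed
  then show ?thesis by blast
qed

text \<open>Both ends always admit a move, and so does an inner index where the step changes:
  \<open>1, 0\<close> can be lowered and \<open>0, 1\<close> raised. A change of step thus gives
  degree at least 3.\<close>

lemma constant_steps:
  assumes s: "path s" and c: "card (nbrs (vert s)) \<le> 2"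
  shows "(\<forall>k\<le>m. s k = s 0) \<or> (\<forall>k\<le>m. s k = s 0 + int k)"
proof (cases "m = 0")
  case False
  have same: "s (Suc k) - s k = s k - s (k - 1)" if k: "0 < k" "k < m" for k
  proof (rule ccontr)
    assume neq: "s (Suc k) - s k \<noteq> s k - s (k - 1)"
    have "card {0, k, m} \<le> card (nbrs (vert s))"
    proof (rule card_nbrs_ge[OF _ s])
      fix i assume i: "i \<in> {0, k, m}"
      then have "i = 0 \<or> i = m \<or> s i - s (i - 1) \<noteq> s (Suc i) - s i" using neq by auto
      moreover have "i \<le> m" "m \<ge> 1" using i k by auto
      ultimately show "\<exists>e\<in>{1, -1}. path (bump s i e)" using path_bump_exists[OF s] by blast
    qed (use k in auto)
    then show False using c k by simp
  qed
  have step: "k < m \<Longrightarrow> s (Suc k) - s k = s 1 - s 0" for k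
  proof (induction k)
    case (Suc k)
    then show ?case using same[of "Suc k"] by simp
  qed simp
  have lin: "k \<le> m \<Longrightarrow> s k = s 0 + int k * (s 1 - s 0)" for k
  proof (induction k)
    case (Suc k)
    have "s k = s 0 + int k * (s 1 - s 0)" using Suc by (meson Suc_leD)
    moreover have "s (Suc k) - s k = s 1 - s 0" by (rule step) (use Suc.prems in simp)
    moreover have "int (Suc k) * (s 1 - s 0) = int k * (s 1 - s 0) + (s 1 - s 0)"
      by (simp only: of_nat_Suc distrib_right mult_1)
    ultimately show ?case by linarith
  qed simp
  have "s 1 - s 0 = 0 \<or> s 1 - s 0 = 1" using path_step[OF s, of 0] False by auto
  then show ?thesis
  proof
    assume d: "s 1 - s 0 = 0"
    have "s k = s 0" if "k \<le> m" for k using lin[OF that] unfolding d by simp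
    then show ?thesis by blast
  next
    assume d: "s 1 - s 0 = 1"
    have "s k = s 0 + int k" if "k \<le> m" for k using lin[OF that] unfolding d by simp
    then show ?thesis by blast
  qed
qed simp

theorem generate_yoke_aut:
  assumes m2: "m \<noteq> 2" and nm: "(n, m) \<noteq> (1, 3)"
  shows "generate (yoke_aut n m) {yoke_phi n m, yoke_psi n m, yoke_tau n m} = carrier (yoke_aut n m)"
    (is "?H = ?C")
proof
  interpret G: group "yoke_aut n m" by (rule group_yoke_aut)
  show HC: "?H \<subseteq> ?C" using generators_in_yoke_aut by (rule G.generate_incl)
  have gen: "yoke_phi n m \<in> ?H" "yoke_psi n m \<in> ?H" "yoke_tau n m \<in> ?H"
    by (auto intro: generate.incl)
  have H: "subgroup ?H (yoke_aut n m)"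
    using generators_in_yoke_aut by (rule G.generate_is_subgroup)
  have ev: "(f \<otimes>\<^bsub>yoke_aut n m\<^esub> g) v = f (g v)"
    if "f \<in> ?C" "g \<in> ?C" "v \<in> yoke_verts n m" for f g v
    using that by (simp add: mult_yoke_aut compose_eq)
  have aut: "yoke_automorphism n m f" if "f \<in> ?C" for f
    using that n_pos by unfold_locales (auto simp: carrier_yoke_aut Bij_def)
  have V0: "vert base \<in> yoke_verts n m" using vert_in_iff by simp
  let ?b = "vert (bump base 0 (- 1))" and ?c = "vert (bump base m 1)"
  have Vbc: "?b \<in> yoke_verts n m" "?c \<in> yoke_verts n m" using vert_in_iff by simp_all
  have rigid: "f = \<one>\<^bsub>yoke_aut n m\<^esub>"
    if f: "f \<in> ?C" "f (vert base) = vert base" "f ?b = ?b" "f ?c = ?c" for f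
  proof -
    interpret yoke_automorphism n m f using f(1) by (rule aut)
    interpret yoke_based_automorphism n m f by unfold_locales (use m2 nm f in auto)
    have "f \<in> extensional (yoke_verts n m)" using f(1) by (simp add: carrier_yoke_aut Bij_def)
    then show ?thesis unfolding one_yoke_aut using fixed by (intro extensionalityI) auto
  qed
  have pconst: "path (\<lambda>_. c)" for c by (simp add: path_def)
  \<comment> \<open>Natural shifts suffice, since the heights reached below are nonnegative or
    reduced modulo \<open>n\<close>.\<close>
  have translates: "\<exists>g\<in>?H. g (vert base) = vert (\<lambda>_. int c)" for c
  proof (induction c)
    case 0
    have "\<one>\<^bsub>yoke_aut n m\<^esub> \<in> ?H" by (rule generate.one)
    then show ?case using V0 by (intro bexI) (auto simp: one_yoke_aut base_def)
  next
    case (Suc c)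
    then obtain g where g: "g \<in> ?H" "g (vert base) = vert (\<lambda>_. int c)" by blast
    have "yoke_phi n m \<otimes>\<^bsub>yoke_aut n m\<^esub> g \<in> ?H" using gen(1) g(1) by (rule generate.eng)
    moreover have "(yoke_phi n m \<otimes>\<^bsub>yoke_aut n m\<^esub> g) (vert base) = vert (\<lambda>_. int c + 1)"
      using g gen(1) HC V0 lifts_vert[OF lifts_translate pconst] by (subst ev) (auto simp: yoke_phi_translate)
    ultimately show ?case by (auto simp: add.commute)
  qed
  have transitive: "\<exists>g\<in>?H. g (vert base) = f (vert base)" if f: "f \<in> ?C" for f
  proof -
    interpret yoke_automorphism n m f using f by (rule aut)
    obtain s where s: "path s" "\<And>k. k \<le> m \<Longrightarrow> s k \<ge> 0" "f (vert base) = vert s"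
      using vert_surj[OF f_in[OF V0]] by metis
    have "card (nbrs (vert s)) = card (nbrs (vert base))" using card_nbrs[OF V0] s by simp
    also have "\<dots> \<le> 2" unfolding nbrs_base by (simp add: card_insert_if)
    finally have "card (nbrs (vert s)) \<le> 2" .
    then consider "\<forall>k\<le>m. s k = s 0" | "\<forall>k\<le>m. s k = s 0 + int k" using constant_steps s(1) by blast
    then show ?thesis
    proof cases
      case 1
      obtain c where c: "s 0 = int c" using s(2)[of 0] nonneg_int_cases by auto
      have "vert s = vert (\<lambda>_. int c)" by (rule vert_cong) (metis 1 c)
      then show ?thesis using translates[of c] s by simp
    next
      case 2
      \<comment> \<open>On slope 1, \<open>yoke_tau\<close> sends the constant height
        \<open>c\<close> to \<open>k - c\<close>, so \<open>c\<close> must be congruent to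
        \<open>- s 0\<close> modulo \<open>n\<close>.\<close>
      have "(- s 0) mod int n \<ge> 0" using n_pos by simp
      then obtain c where c: "(- s 0) mod int n = int c" using nonneg_int_cases by auto
      obtain g where g: "g \<in> ?H" "g (vert base) = vert (\<lambda>_. int c)" using translates by blast
      have "(yoke_tau n m \<otimes>\<^bsub>yoke_aut n m\<^esub> g) (vert base) = vert (\<lambda>k. int k - int c)"
        using g gen(3) HC V0 lifts_vert[OF lifts_tau pconst] by (subst ev) auto
      also have "\<dots> = vert s"
      proof (rule vert_eqI)
        fix k assume "k \<le> m"
        then have "s k = s 0 + int k" using 2 by blast
        moreover have "(- s 0 div int n) * int n + int c = - s 0"
          using div_mult_mod_eq[of "- s 0" "int n"] unfolding c .
        ultimately show "int k - int c = s k + (- s 0 div int n) * int n" by linarith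
      qed
      finally show ?thesis using gen(3) g(1) s(3) generate.eng by metis
    qed
  qed
  show "?C \<subseteq> ?H"
  proof
    fix f assume f: "f \<in> ?C"
    obtain g where g: "g \<in> ?H" "g (vert base) = f (vert base)" using transitive[OF f] by blast
    have gC: "g \<in> ?C" using g HC by blast
    \<comment> \<open>Dividing by \<open>g\<close> leaves an automorphism that fixes zero and
      therefore permutes its two neighbours.\<close>
    define h where "h = inv\<^bsub>yoke_aut n m\<^esub> g \<otimes>\<^bsub>yoke_aut n m\<^esub> f"
    have hC: "h \<in> ?C" using gC f by (simp add: h_def)
    have gh: "g \<otimes>\<^bsub>yoke_aut n m\<^esub> h = f" using gC f by (simp add: h_def G.m_assoc[symmetric])
    interpret g: yoke_automorphism n m g using gC by (rule aut)
    interpret h: yoke_automorphism n m h using hC by (rule aut)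
    have "g (h (vert base)) = g (vert base)" using ev[OF gC hC V0] gh g(2) by simp
    then have h0: "h (vert base) = vert base" using g.f_inj[OF h.f_in[OF V0] V0] by simp
    then have him: "h ` {?b, ?c} = {?b, ?c}" using h.nbrs_image[OF V0] unfolding h0 nbrs_base by (simp only:)
    have inj: "h ?b = h ?c \<longleftrightarrow> ?b = ?c" using h.f_inj[OF Vbc] .
    have mem: "h ?b = ?b \<or> h ?b = ?c" "h ?c = ?b \<or> h ?c = ?c"
      using equalityD1[OF him] by simp_all
    have psi: "yoke_psi n m \<in> ?C" using gen HC by blast
    show "f \<in> ?H"
    proof (cases "h ?b = ?b")
      case True
      then have "h ?c = ?c" using mem inj by metis
      then have "h = \<one>\<^bsub>yoke_aut n m\<^esub>" using rigid hC h0 True by blast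
      then show ?thesis using gh gC g(1) by simp
    next
      case False
      then have hbc: "h ?b = ?c" "h ?c = ?b" using mem inj by metis+
      have pb: "path (bump base 0 (- 1))" "path (bump base m 1)" by simp_all
      have "yoke_psi n m ?b = ?c" "yoke_psi n m ?c = ?b" "yoke_psi n m (vert base) = vert base"
        unfolding lifts_vert[OF lifts_psi pb(1)] lifts_vert[OF lifts_psi pb(2)]
          lifts_vert[OF lifts_psi path_base]
        by (rule vert_cong, auto simp: bump_def base_def)+
      \<comment> \<open>Both \<open>h\<close> and \<open>yoke_psi\<close> swap the neighbours of
        zero, so rigidity applies to their product.\<close>
      then have "yoke_psi n m \<otimes>\<^bsub>yoke_aut n m\<^esub> h = \<one>\<^bsub>yoke_aut n m\<^esub>"
        using hbc h0 V0 Vbc psi hC by (intro rigid) (simp_all add: ev)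
      then have "h = inv\<^bsub>yoke_aut n m\<^esub> (yoke_psi n m)"
        using psi hC by (metis G.inv_equality G.inv_inv)
      then have "h \<in> ?H" using gen(2) H by (simp add: subgroup.m_inv_closed)
      then show ?thesis using gh g(1) generate.eng by metis
    qed
  qed
qed

end

lemma yoke_A_eq_yoke_aut:
  assumes "n \<ge> 1" "m \<noteq> 2" "(n, m) \<noteq> (1, 3)"
  shows "yoke_A n m = yoke_aut n m"
proof -
  interpret yoke n m using assms(1) by unfold_locales
  show ?thesis using generate_yoke_aut[OF assms(2,3)] by (simp add: yoke_A_def)
qed

section \<open>The exceptional graph\<close>

declare One_nat_def [simp del]

text \<open>P consists of the vertices whose first and last inner entries differ, indexed modulo 4
  so that \<open>k\<close> and \<open>k + 2\<close> are opposite. All integers are accepted as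
  indices, so that the dihedral action becomes the affine map sending \<open>k\<close> to
  \<open>a\<close> plus or minus \<open>k\<close>.\<close>

definition vP :: "int \<Rightarrow> int list" where
  "vP k = [0, (k mod 4) div 2, k mod 2, 1 - (k mod 4) div 2, 0]"

definition vQ :: "int \<Rightarrow> int list" where
  "vQ k = [0, k mod 2, k mod 2, k mod 2, 0]"

definition vR :: "int \<Rightarrow> int list" where
  "vR k = [0, k mod 2, 1 - k mod 2, k mod 2, 0]"

lemma mod4_cases:
  "(k::int) mod 4 = 0 \<and> k mod 2 = 0 \<or> k mod 4 = 1 \<and> k mod 2 = 1
   \<or> k mod 4 = 2 \<and> k mod 2 = 0 \<or> k mod 4 = 3 \<and> k mod 2 = 1"
  by presburger

lemma vP_forms:
  "vP k = [0,0,0,1,0] \<and> k mod 4 = 0 \<and> even k \<or> vP k = [0,0,1,1,0] \<and> k mod 4 = 1 \<and> odd k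
   \<or> vP k = [0,1,0,0,0] \<and> k mod 4 = 2 \<and> even k \<or> vP k = [0,1,1,0,0] \<and> k mod 4 = 3 \<and> odd k"
  using mod4_cases[of k] by (elim disjE) (simp_all add: vP_def even_iff_mod_2_eq_zero)

lemma vQ_forms: "vQ k = [0,0,0,0,0] \<and> even k \<or> vQ k = [0,1,1,1,0] \<and> odd k"
  by (cases "even k") (simp_all add: vQ_def even_iff_mod_2_eq_zero odd_iff_mod_2_eq_one)

lemma vR_forms: "vR k = [0,0,1,0,0] \<and> even k \<or> vR k = [0,1,0,1,0] \<and> odd k"
  by (cases "even k") (simp_all add: vR_def even_iff_mod_2_eq_zero odd_iff_mod_2_eq_one)

lemma vP_eq_iff: "vP k = vP l \<longleftrightarrow> k mod 4 = l mod 4"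
  using vP_forms[of k] vP_forms[of l] by (elim disjE) simp_all

lemma vQ_eq_iff: "vQ k = vQ l \<longleftrightarrow> k mod 2 = l mod 2"
  by (simp add: vQ_def)

lemma vR_eq_iff: "vR k = vR l \<longleftrightarrow> k mod 2 = l mod 2"
  by (auto simp: vR_def)

lemma vPQR_distinct [simp]:
  "vP k \<noteq> vQ l" "vP k \<noteq> vR l" "vQ k \<noteq> vR l" "vQ l \<noteq> vP k" "vR l \<noteq> vP k" "vR l \<noteq> vQ k"
proof -
  show "vP k \<noteq> vQ l" using vP_forms[of k] vQ_forms[of l] by (elim disjE) simp_all
  then show "vQ l \<noteq> vP k" by metis
  show "vP k \<noteq> vR l" using vP_forms[of k] vR_forms[of l] by (elim disjE) simp_all
  then show "vR l \<noteq> vP k" by metis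
  show "vQ k \<noteq> vR l" using vQ_forms[of k] vR_forms[of l] by (elim disjE) simp_all
  show "vR l \<noteq> vQ k" using vQ_forms[of k] vR_forms[of l] by (elim disjE) simp_all
qed

text \<open>Modulo 1 both buckets are 0 and the sum condition is void, which leaves the eight bit
  triples.\<close>

lemma mem_verts13: "v \<in> yoke_verts 1 3 \<longleftrightarrow>
  (\<exists>a b c. v = [0, a, b, c, 0] \<and> a \<in> {0, 1} \<and> b \<in> {0, 1} \<and> c \<in> {0, 1})"
proof
  assume v: "v \<in> yoke_verts 1 3"
  then have "length v = Suc (Suc (Suc (Suc (Suc 0))))" by (simp add: yoke_verts_def)
  then obtain x a b c y where l: "v = [x, a, b, c, y]" by (auto simp: length_Suc_conv)
  have "v ! 0 \<in> {0..<1}" "v ! 4 \<in> {0..<1}" "v ! 1 \<in> {0, 1}" "v ! 2 \<in> {0, 1}" "v ! 3 \<in> {0, 1}"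
    using v by (auto simp: yoke_verts_def)
  then show "\<exists>a b c. v = [0, a, b, c, 0] \<and> a \<in> {0, 1} \<and> b \<in> {0, 1} \<and> c \<in> {0, 1}"
    using l by auto
next
  assume "\<exists>a b c. v = [0, a, b, c, 0] \<and> a \<in> {0, 1} \<and> b \<in> {0, 1} \<and> c \<in> {0, 1}"
  then obtain a b c where v: "v = [0, a, b, c, 0]" "a \<in> {0, 1}" "b \<in> {0, 1}" "c \<in> {0, 1}" by blast
  have "v ! i \<in> {0, 1}" if "1 \<le> i" "i \<le> 3" for i
  proof -
    have "i = 1 \<or> i = 2 \<or> i = 3" using that by linarith
    then show ?thesis using v by auto
  qed
  then show "v \<in> yoke_verts 1 3" using v(1) by (simp add: yoke_verts_def)
qed

lemma list_in_verts13: "[0, a, b, c, 0] \<in> yoke_verts 1 3 \<longleftrightarrow> a \<in> {0, 1} \<and> b \<in> {0, 1} \<and> c \<in> {0, 1}"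
  by (simp add: mem_verts13)

lemma vPQR_in [simp]: "vP k \<in> yoke_verts 1 3" "vQ k \<in> yoke_verts 1 3" "vR k \<in> yoke_verts 1 3"
proof -
  show "vP k \<in> yoke_verts 1 3"
    using vP_forms[of k] by (elim disjE conjE) (simp_all only: list_in_verts13, simp_all)
  show "vQ k \<in> yoke_verts 1 3"
    using vQ_forms[of k] by (elim disjE conjE) (simp_all only: list_in_verts13, simp_all)
  show "vR k \<in> yoke_verts 1 3"
    using vR_forms[of k] by (elim disjE conjE) (simp_all only: list_in_verts13, simp_all)
qed

lemma verts13_cases:
  assumes "v \<in> yoke_verts 1 3"
  obtains k where "v = vP k" | k where "v = vQ k" | k where "v = vR k"
proof -
  obtain a b c where v: "v = [0, a, b, c, 0]" "a \<in> {0, 1}" "b \<in> {0, 1}" "c \<in> {0, 1}"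
    using assms unfolding mem_verts13 by blast
  have "v \<in> {vP 0, vP 1, vP 2, vP 3, vQ 0, vQ 1, vR 0, vR 1}"
    using v by (auto simp: vP_def vQ_def vR_def)
  then show thesis using that by blast
qed

text \<open>Moves 0 and 3 exchange a unit with a bucket and flip an outer bit; moves 1 and 2 swap
  two neighbouring bits.\<close>

lemma adj13:
  assumes "[0, a, b, c, 0] \<in> yoke_verts 1 3" "[0, a', b', c', 0] \<in> yoke_verts 1 3"
  shows "yoke_adj 1 3 [0, a, b, c, 0] [0, a', b', c', 0] \<longleftrightarrow>
    (a \<noteq> a' \<and> b = b' \<and> c = c') \<or> (a = a' \<and> b = b' \<and> c \<noteq> c') \<or>
    (a \<noteq> b \<and> a' = b \<and> b' = a \<and> c = c') \<or> (b \<noteq> c \<and> a = a' \<and> b' = c \<and> c' = b)"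
proof -
  have ex: "(\<exists>i\<le>3. P i) \<longleftrightarrow> P 0 \<or> P 1 \<or> P 2 \<or> P (3::nat)" for P
    by (auto simp: One_nat_def numeral_eq_Suc le_Suc_eq)
  have all: "(\<forall>j<3+2. P j) \<longleftrightarrow> P 0 \<and> P 1 \<and> P 2 \<and> P 3 \<and> P (4::nat)" for P
    by (auto simp: One_nat_def numeral_eq_Suc less_Suc_eq)
  have "a \<in> {0, 1}" "b \<in> {0, 1}" "c \<in> {0, 1}" "a' \<in> {0, 1}" "b' \<in> {0, 1}" "c' \<in> {0, 1}"
    using assms by (auto simp: mem_verts13)
  then show ?thesis
    using assms unfolding yoke_adj_def ex all yoke_shift_def by (simp, elim disjE; simp)
qed

lemma adj_vPQR:
  "\<not> yoke_adj 1 3 (vP k) (vP l)"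
  "yoke_adj 1 3 (vP k) (vQ l) \<longleftrightarrow> even (k + l)" "yoke_adj 1 3 (vQ l) (vP k) \<longleftrightarrow> even (k + l)"
  "yoke_adj 1 3 (vP k) (vR l)" "yoke_adj 1 3 (vR l) (vP k)"
  "\<not> yoke_adj 1 3 (vQ k) (vQ l)"
  "\<not> yoke_adj 1 3 (vQ k) (vR l)" "\<not> yoke_adj 1 3 (vR l) (vQ k)"
  "\<not> yoke_adj 1 3 (vR k) (vR l)"
proof -
  note P = vP_forms[of k] vP_forms[of l] and Q = vQ_forms[of k] vQ_forms[of l]
    and R = vR_forms[of k] vR_forms[of l] and adj13 [simp] list_in_verts13 [simp]
  show "\<not> yoke_adj 1 3 (vP k) (vP l)" using P by (elim disjE) simp_all
  show "yoke_adj 1 3 (vP k) (vQ l) \<longleftrightarrow> even (k + l)" using P(1) Q(2) by (elim disjE) simp_all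
  show "yoke_adj 1 3 (vQ l) (vP k) \<longleftrightarrow> even (k + l)" using P(1) Q(2) by (elim disjE) simp_all
  show "yoke_adj 1 3 (vP k) (vR l)" using P(1) R(2) by (elim disjE) simp_all
  show "yoke_adj 1 3 (vR l) (vP k)" using P(1) R(2) by (elim disjE) simp_all
  show "\<not> yoke_adj 1 3 (vQ k) (vQ l)" using Q by (elim disjE) simp_all
  show "\<not> yoke_adj 1 3 (vQ k) (vR l)" using Q(1) R(2) by (elim disjE) simp_all
  show "\<not> yoke_adj 1 3 (vR l) (vQ k)" using Q(1) R(2) by (elim disjE) simp_all
  show "\<not> yoke_adj 1 3 (vR k) (vR l)" using R by (elim disjE) simp_all
qed

section \<open>The action of the product group\<close>

definition sg :: "int \<Rightarrow> int" where "sg s = (if s = 0 then 1 else - 1)"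

text \<open>The tests on the entries recognise P, Q and R, and the arithmetic recovers the index. On
  Q the sign disappears modulo 2, so only the rotation \<open>a\<close> acts there.\<close>

definition dihedral_act :: "(int \<times> int) \<times> int \<Rightarrow> int list \<Rightarrow> int list" where
  "dihedral_act = (\<lambda>((a, s), t). \<lambda>v \<in> yoke_verts 1 3.
     if v ! 1 \<noteq> v ! 3 then vP (a + sg s * (2 * v ! 1 + v ! 2))
     else if v ! 1 = v ! 2 then vQ (a + v ! 1)
     else vR (t + v ! 1))"

lemma sg_cases: "sg s = 1 \<or> sg s = - 1"
  by (simp add: sg_def)

lemma mod4_affine: "((a::int) + b * (k mod 4)) mod 4 = (a + b * k) mod 4"
  by (metis mod_add_right_eq mod_mult_right_eq)

lemma dihedral_act_vPQR:
  "dihedral_act ((a, s), t) (vP k) = vP (a + sg s * k)"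
  "dihedral_act ((a, s), t) (vQ k) = vQ (a + k)"
  "dihedral_act ((a, s), t) (vR k) = vR (t + k)"
proof -
  have "dihedral_act ((a, s), t) (vP k) = vP (a + sg s * (k mod 4))"
    using vP_forms[of k] vPQR_in(1)[of k] unfolding dihedral_act_def by (elim disjE) simp_all
  then show "dihedral_act ((a, s), t) (vP k) = vP (a + sg s * k)"
    using vP_eq_iff mod4_affine by metis
  have "dihedral_act ((a, s), t) (vQ k) = vQ (a + k mod 2)"
    using vQ_forms[of k] vPQR_in(2)[of k] unfolding dihedral_act_def
    by (elim disjE) (simp_all add: even_iff_mod_2_eq_zero odd_iff_mod_2_eq_one)
  then show "dihedral_act ((a, s), t) (vQ k) = vQ (a + k)" by (simp add: vQ_eq_iff mod_add_right_eq)
  have "dihedral_act ((a, s), t) (vR k) = vR (t + k mod 2)"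
    using vR_forms[of k] vPQR_in(3)[of k] unfolding dihedral_act_def
    by (elim disjE) (simp_all add: even_iff_mod_2_eq_zero odd_iff_mod_2_eq_one)
  then show "dihedral_act ((a, s), t) (vR k) = vR (t + k)" by (simp add: vR_eq_iff mod_add_right_eq)
qed

lemma dihedral_act_extensional: "dihedral_act g \<in> extensional (yoke_verts 1 3)"
  by (auto simp: dihedral_act_def split: prod.splits)

lemma eq_on_verts13I:
  assumes "f \<in> extensional (yoke_verts 1 3)" "g \<in> extensional (yoke_verts 1 3)"
    and "\<And>k. f (vP k) = g (vP k)" "\<And>k. f (vQ k) = g (vQ k)" "\<And>k. f (vR k) = g (vR k)"
  shows "f = g"
proof (rule extensionalityI[OF assms(1,2)])
  fix v assume "v \<in> yoke_verts 1 3"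
  then show "f v = g v" by (rule verts13_cases) (use assms in simp_all)
qed

lemma finite_verts13: "finite (yoke_verts 1 3)"
proof -
  have "yoke_verts 1 3 \<subseteq> (\<lambda>(a, b, c). [0, a, b, c, 0]) ` ({0, 1} \<times> {0, 1} \<times> {0, 1})"
    by (auto simp: mem_verts13)
  then show ?thesis by (rule finite_subset) simp
qed

text \<open>The only adjacency that depends on indices is the parity of \<open>k + l\<close> between
  P and Q, and adding \<open>a\<close> to both indices or changing the sign of \<open>k\<close>
  preserves it. Injectivity suffices for a bijection on a finite set.\<close>

lemma dihedral_act_in_yoke_aut: "dihedral_act g \<in> carrier (yoke_aut 1 3)"
proof -
  obtain a s t where g: "g = ((a, s), t)" by (metis surj_pair)
  have adj: "yoke_adj 1 3 u v \<longleftrightarrow> yoke_adj 1 3 (dihedral_act g u) (dihedral_act g v)"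
    if "u \<in> yoke_verts 1 3" "v \<in> yoke_verts 1 3" for u v
    using that(1)
  proof (rule verts13_cases)
    fix k assume u: "u = vP k"
    show ?thesis using that(2)
      by (rule verts13_cases) (use sg_cases[of s] in \<open>auto simp: u g dihedral_act_vPQR adj_vPQR\<close>)
  next
    fix k assume u: "u = vQ k"
    show ?thesis using that(2)
      by (rule verts13_cases) (use sg_cases[of s] in \<open>auto simp: u g dihedral_act_vPQR adj_vPQR\<close>)
  next
    fix k assume u: "u = vR k"
    show ?thesis using that(2)
      by (rule verts13_cases) (use sg_cases[of s] in \<open>auto simp: u g dihedral_act_vPQR adj_vPQR\<close>)
  qed
  have P: "(a + sg s * k) mod 4 = (a + sg s * l) mod 4 \<longleftrightarrow> k mod 4 = l mod 4" for k l
  proof -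
    have "(a + sg s * k) mod 4 = (a + sg s * l) mod 4 \<longleftrightarrow> 4 dvd sg s * (k - l)"
      by (simp add: mod_eq_dvd_iff algebra_simps)
    also have "\<dots> \<longleftrightarrow> 4 dvd k - l" using sg_cases[of s] by (auto simp: dvd_diff_commute)
    finally show ?thesis by (simp add: mod_eq_dvd_iff)
  qed
  have Q: "(c + k) mod 2 = (c + l) mod 2 \<longleftrightarrow> k mod 2 = l mod 2" for c k l :: int
    by (simp add: mod_eq_dvd_iff)
  have "inj_on (dihedral_act g) (yoke_verts 1 3)"
  proof (rule inj_onI)
    fix u v assume uv: "u \<in> yoke_verts 1 3" "v \<in> yoke_verts 1 3" and eq: "dihedral_act g u = dihedral_act g v"
    show "u = v" using uv(1)
    proof (rule verts13_cases)
      fix k assume u: "u = vP k"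
      show ?thesis using uv(2)
        by (rule verts13_cases) (use eq in \<open>auto simp: u g dihedral_act_vPQR vP_eq_iff P\<close>)
    next
      fix k assume u: "u = vQ k"
      show ?thesis using uv(2)
        by (rule verts13_cases) (use eq in \<open>auto simp: u g dihedral_act_vPQR vQ_eq_iff Q\<close>)
    next
      fix k assume u: "u = vR k"
      show ?thesis using uv(2)
        by (rule verts13_cases) (use eq in \<open>auto simp: u g dihedral_act_vPQR vR_eq_iff Q\<close>)
    qed
  qed
  moreover have "dihedral_act g ` yoke_verts 1 3 \<subseteq> yoke_verts 1 3"
  proof (rule image_subsetI)
    fix v assume "v \<in> yoke_verts 1 3"
    then show "dihedral_act g v \<in> yoke_verts 1 3"
      by (rule verts13_cases) (simp_all add: g dihedral_act_vPQR)
  qed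
  ultimately have "bij_betw (dihedral_act g) (yoke_verts 1 3) (yoke_verts 1 3)"
    using finite_verts13 by (simp add: bij_betw_def endo_inj_surj)
  then show ?thesis using adj dihedral_act_extensional by (simp add: carrier_yoke_aut Bij_def)
qed

lemma dihedral4_simps:
  "carrier dihedral4 = {0..<4} \<times> {0..<2}"
  "(a, s) \<otimes>\<^bsub>dihedral4\<^esub> (b, t) = ((a + sg s * b) mod 4, (s + t) mod 2)"
  "\<one>\<^bsub>dihedral4\<^esub> = (0, 0)"
  by (simp_all add: dihedral4_def sg_def)

lemma cyclic2_simps: "carrier cyclic2 = {0..<2}" "t \<otimes>\<^bsub>cyclic2\<^esub> u = (t + u) mod 2"
  by (simp_all add: cyclic2_def integer_mod_group_def)

lemma sg_add: "s \<in> {0..<2} \<Longrightarrow> t \<in> {0..<2} \<Longrightarrow> sg ((s + t) mod 2) = sg s * sg t"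
proof -
  assume "s \<in> {0..<2}" "t \<in> {0..<2}"
  then have "s = 0 \<or> s = 1" "t = 0 \<or> t = 1" by auto
  then show ?thesis by (auto simp: sg_def)
qed

lemma group_dihedral4: "group dihedral4"
proof (rule groupI)
  fix x y assume "x \<in> carrier dihedral4" "y \<in> carrier dihedral4"
  then show "x \<otimes>\<^bsub>dihedral4\<^esub> y \<in> carrier dihedral4"
    by (cases x; cases y) (simp add: dihedral4_simps)
next
  fix x y z assume "x \<in> carrier dihedral4" "y \<in> carrier dihedral4" "z \<in> carrier dihedral4"
  then obtain a s b t c u where x: "x = (a, s)" "s \<in> {0..<2}" and y: "y = (b, t)" "t \<in> {0..<2}"
    and z: "z = (c, u)"
    by (cases x; cases y; cases z) (auto simp: dihedral4_simps)
  have "((a + sg s * b) mod 4 + sg s * sg t * c) mod 4 = (a + sg s * ((b + sg t * c) mod 4)) mod 4"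
    unfolding mod4_affine mod_add_left_eq by (simp add: algebra_simps)
  then show "x \<otimes>\<^bsub>dihedral4\<^esub> y \<otimes>\<^bsub>dihedral4\<^esub> z = x \<otimes>\<^bsub>dihedral4\<^esub> (y \<otimes>\<^bsub>dihedral4\<^esub> z)"
    using x y z by (simp add: dihedral4_simps sg_add mod_simps add.assoc)
next
  show "\<one>\<^bsub>dihedral4\<^esub> \<in> carrier dihedral4" by (simp add: dihedral4_simps)
next
  fix x assume "x \<in> carrier dihedral4"
  then show "\<one>\<^bsub>dihedral4\<^esub> \<otimes>\<^bsub>dihedral4\<^esub> x = x"
    by (cases x) (simp add: dihedral4_simps sg_def)
next
  fix x assume x: "x \<in> carrier dihedral4"
  then obtain a s where as: "x = (a, s)" "s \<in> {0..<2}" by (cases x) (auto simp: dihedral4_simps)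
  then have s: "s = 0 \<or> s = 1" by auto
  \<comment> \<open>Rotations are inverted by negating the angle, while a reflection is its own
    inverse; the sign covers both.\<close>
  have "((- sg s * a) mod 4, s) \<in> carrier dihedral4" using as s by (auto simp: dihedral4_simps)
  moreover have "((- sg s * a) mod 4, s) \<otimes>\<^bsub>dihedral4\<^esub> x = \<one>\<^bsub>dihedral4\<^esub>"
    using as s by (auto simp: dihedral4_simps mod_add_left_eq)
  ultimately show "\<exists>y\<in>carrier dihedral4. y \<otimes>\<^bsub>dihedral4\<^esub> x = \<one>\<^bsub>dihedral4\<^esub>" by blast
qed

lemma dihedral_act_mult:
  assumes "g \<in> carrier (dihedral4 \<times>\<times> cyclic2)" "h \<in> carrier (dihedral4 \<times>\<times> cyclic2)"
  shows "dihedral_act (g \<otimes>\<^bsub>dihedral4 \<times>\<times> cyclic2\<^esub> h) = dihedral_act g \<otimes>\<^bsub>yoke_aut 1 3\<^esub> dihedral_act h"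
proof -
  obtain a s t b u w where g: "g = ((a, s), t)" "s \<in> {0..<2}" and h: "h = ((b, u), w)" "u \<in> {0..<2}"
    using assms by (auto simp: DirProd_def dihedral4_simps)
  have gh: "g \<otimes>\<^bsub>dihedral4 \<times>\<times> cyclic2\<^esub> h = (((a + sg s * b) mod 4, (s + u) mod 2), (t + w) mod 2)"
    using g h by (simp add: DirProd_def dihedral4_simps cyclic2_simps)
  \<comment> \<open>Modulo 2 neither the sign nor the reduction modulo 4 is visible, so the shifts
    on Q simply add.\<close>
  have Q: "((a + sg s * b) mod 4 + k) mod 2 = (a + (b + k)) mod 2" for k
  proof -
    have "(x mod 4 + k) mod 2 = (x + k) mod 2" for x :: int by presburger
    moreover have "(a + b + k) mod 2 = (a + (b + k)) mod 2" "(a - b + k) mod 2 = (a + (b + k)) mod 2"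
      by presburger+
    ultimately show ?thesis using sg_cases[of s] by (elim disjE) simp_all
  qed
  have m: "dihedral_act g \<otimes>\<^bsub>yoke_aut 1 3\<^esub> dihedral_act h = compose (yoke_verts 1 3) (dihedral_act g) (dihedral_act h)"
    by (rule mult_yoke_aut) (rule dihedral_act_in_yoke_aut)+
  show ?thesis unfolding gh m
  proof (rule eq_on_verts13I)
    fix k
    show "dihedral_act (((a + sg s * b) mod 4, (s + u) mod 2), (t + w) mod 2) (vP k)
        = compose (yoke_verts 1 3) (dihedral_act g) (dihedral_act h) (vP k)"
      using g h by (simp add: compose_eq dihedral_act_vPQR vP_eq_iff sg_add mod_simps algebra_simps)
    show "dihedral_act (((a + sg s * b) mod 4, (s + u) mod 2), (t + w) mod 2) (vQ k)
        = compose (yoke_verts 1 3) (dihedral_act g) (dihedral_act h) (vQ k)"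
      using g h by (simp add: compose_eq dihedral_act_vPQR vQ_eq_iff Q)
    show "dihedral_act (((a + sg s * b) mod 4, (s + u) mod 2), (t + w) mod 2) (vR k)
        = compose (yoke_verts 1 3) (dihedral_act g) (dihedral_act h) (vR k)"
      using g h by (simp add: compose_eq dihedral_act_vPQR vR_eq_iff mod_simps add.assoc)
  qed (simp_all add: dihedral_act_extensional)
qed

text \<open>The image of \<open>vP 0\<close> reveals the rotation, that of \<open>vP 1\<close> the
  sign because \<open>b + 1\<close> and \<open>b - 1\<close> differ modulo 4, and that of
  \<open>vR 0\<close> the cyclic part.\<close>

lemma inj_on_dihedral_act: "inj_on dihedral_act (carrier (dihedral4 \<times>\<times> cyclic2))"
proof (rule inj_onI)
  fix g h assume gh: "g \<in> carrier (dihedral4 \<times>\<times> cyclic2)" "h \<in> carrier (dihedral4 \<times>\<times> cyclic2)"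
    and eq: "dihedral_act g = dihedral_act h"
  obtain a s t where g: "g = ((a, s), t)" "a \<in> {0..<4}" "s \<in> {0..<2}" "t \<in> {0..<2}"
    using gh(1) by (cases g) (auto simp: DirProd_def dihedral4_simps cyclic2_simps)
  obtain b u w where h: "h = ((b, u), w)" "b \<in> {0..<4}" "u \<in> {0..<2}" "w \<in> {0..<2}"
    using gh(2) by (cases h) (auto simp: DirProd_def dihedral4_simps cyclic2_simps)
  have "a mod 4 = b mod 4"
    using fun_cong[OF eq, of "vP 0"] unfolding g(1) h(1) dihedral_act_vPQR vP_eq_iff by simp
  then have "a = b" using g h by simp
  moreover have "(a + sg s * 1) mod 4 = (b + sg u * 1) mod 4"
    using fun_cong[OF eq, of "vP 1"] unfolding g(1) h(1) dihedral_act_vPQR vP_eq_iff .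
  then have "s = u" 
  proof -
    have "s = 0 \<or> s = 1" "u = 0 \<or> u = 1" using g(3) h(3) by auto
    moreover have "(b + 1) mod 4 \<noteq> (b - 1) mod 4" unfolding mod_eq_dvd_iff by simp
    ultimately show ?thesis
      using \<open>(a + sg s * 1) mod 4 = (b + sg u * 1) mod 4\<close> \<open>a = b\<close> by (auto simp: sg_def)
  qed
  moreover have "t mod 2 = w mod 2"
    using fun_cong[OF eq, of "vR 0"] unfolding g(1) h(1) dihedral_act_vPQR vR_eq_iff by simp
  then have "t = w" using g h by simp
  ultimately show "g = h" using g h by simp
qed

section \<open>Every automorphism comes from the action\<close>

lemma nbrs13:
  "yoke.nbrs 1 3 (vP k) = {vQ k, vR 0, vR 1}"
  "yoke.nbrs 1 3 (vQ k) = {vP k, vP (k + 2)}"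
  "yoke.nbrs 1 3 (vR k) = {vP 0, vP 1, vP 2, vP 3}"
proof -
  interpret yoke 1 3 by unfold_locales simp
  have in_V: "u \<in> yoke_verts 1 3" if "u \<in> nbrs v" for u v using that by (simp add: nbrs_def yoke_adj_def)
  have R: "vR l = vR 0 \<or> vR l = vR 1" for l
    using mod4_cases[of l] by (auto simp: vR_eq_iff)
  have P: "vP l = vP 0 \<or> vP l = vP 1 \<or> vP l = vP 2 \<or> vP l = vP 3" for l
    unfolding vP_eq_iff using mod4_cases[of l] by auto
  have Q: "vQ l = vQ k" if "even (k + l)" for l using that unfolding vQ_eq_iff by presburger
  have PQ: "vP l = vP k \<or> vP l = vP (k + 2)" if "even (l + k)" for l
    using that unfolding vP_eq_iff mod_eq_dvd_iff by presburger
  show "nbrs (vP k) = {vQ k, vR 0, vR 1}"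
  proof (intro equalityI subsetI)
    fix u assume u: "u \<in> nbrs (vP k)"
    from in_V[OF u] show "u \<in> {vQ k, vR 0, vR 1}"
    proof (rule verts13_cases)
      fix l assume l: "u = vQ l"
      then have "even (k + l)" using u by (simp add: nbrs_def adj_vPQR)
      then show ?thesis unfolding l using Q by blast
    next
      fix l assume l: "u = vR l"
      show ?thesis unfolding l using R[of l] by blast
    qed (use u in \<open>simp add: nbrs_def adj_vPQR\<close>)
  qed (auto simp: nbrs_def adj_vPQR)
  show "nbrs (vQ k) = {vP k, vP (k + 2)}"
  proof (intro equalityI subsetI)
    fix u assume u: "u \<in> nbrs (vQ k)"
    from in_V[OF u] show "u \<in> {vP k, vP (k + 2)}"
    proof (rule verts13_cases)
      fix l assume l: "u = vP l"
      then have "even (l + k)" using u by (simp add: nbrs_def adj_vPQR)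
      then show ?thesis unfolding l using PQ by blast
    qed (use u in \<open>simp_all add: nbrs_def adj_vPQR\<close>)
  qed (auto simp: nbrs_def adj_vPQR)
  show "nbrs (vR k) = {vP 0, vP 1, vP 2, vP 3}"
  proof (intro equalityI subsetI)
    fix u assume u: "u \<in> nbrs (vR k)"
    from in_V[OF u] show "u \<in> {vP 0, vP 1, vP 2, vP 3}"
    proof (rule verts13_cases)
      fix l assume l: "u = vP l"
      show ?thesis unfolding l using P[of l] by blast
    qed (use u in \<open>simp_all add: nbrs_def adj_vPQR\<close>)
  qed (auto simp: nbrs_def adj_vPQR)
qed

text \<open>The three degrees are distinct, so every automorphism preserves each of P, Q and
  R.\<close>

lemma card_nbrs13:
  "card (yoke.nbrs 1 3 (vP k)) = 3" "card (yoke.nbrs 1 3 (vQ k)) = 2" "card (yoke.nbrs 1 3 (vR k)) = 4"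
proof -
  have "vP k \<noteq> vP (k + 2)" unfolding vP_eq_iff by presburger
  then show "card (yoke.nbrs 1 3 (vP k)) = 3" "card (yoke.nbrs 1 3 (vQ k)) = 2" "card (yoke.nbrs 1 3 (vR k)) = 4"
    by (simp_all add: nbrs13 vR_eq_iff vP_eq_iff)
qed

text \<open>Each parity class contains exactly two residues modulo 4.\<close>

lemma two_more_or_less:
  fixes x y :: int
  shows "even (y - x) \<Longrightarrow> y mod 4 \<noteq> x mod 4 \<Longrightarrow> y mod 4 = (x + 2) mod 4"
    "odd (y - x) \<Longrightarrow> y mod 4 \<noteq> (x + 1) mod 4 \<Longrightarrow> y mod 4 = (x - 1) mod 4"
  unfolding mod_eq_dvd_iff by presburger+

lemma dihedral_act_surj:
  assumes f: "f \<in> carrier (yoke_aut 1 3)"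
  shows "f \<in> dihedral_act ` carrier (dihedral4 \<times>\<times> cyclic2)"
proof -
  interpret yoke_automorphism 1 3 f
    using f by unfold_locales (auto simp: carrier_yoke_aut Bij_def)
  have P: "\<exists>l. l \<in> {0..<4} \<and> f (vP k) = vP l" for k
  proof -
    have card: "card (nbrs (f (vP k))) = 3" using card_nbrs card_nbrs13 by simp
    have "f (vP k) \<in> yoke_verts 1 3" by (rule f_in) simp
    then have "\<exists>l. f (vP k) = vP l" by (rule verts13_cases) (use card card_nbrs13 in auto)
    then obtain l where "f (vP k) = vP l" ..
    moreover have "vP l = vP (l mod 4)" by (simp add: vP_eq_iff)
    ultimately show ?thesis by (intro exI[of _ "l mod 4"]) simp
  qed
  have Q: "\<exists>l. f (vQ k) = vQ l" for k
  proof -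
    have card: "card (nbrs (f (vQ k))) = 2" using card_nbrs card_nbrs13 by simp
    have "f (vQ k) \<in> yoke_verts 1 3" by (rule f_in) simp
    then show ?thesis by (rule verts13_cases) (use card card_nbrs13 in auto)
  qed
  have R: "\<exists>l. l \<in> {0..<2} \<and> f (vR k) = vR l" for k
  proof -
    have card: "card (nbrs (f (vR k))) = 4" using card_nbrs card_nbrs13 by simp
    have "f (vR k) \<in> yoke_verts 1 3" by (rule f_in) simp
    then have "\<exists>l. f (vR k) = vR l" by (rule verts13_cases) (use card card_nbrs13 in auto)
    then obtain l where "f (vR k) = vR l" ..
    moreover have "vR l = vR (l mod 2)" by (simp add: vR_eq_iff)
    ultimately show ?thesis by (intro exI[of _ "l mod 2"]) simp
  qed
  obtain p where p: "\<And>k. p k \<in> {0..<4} \<and> f (vP k) = vP (p k)" using P by metis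
  obtain q where q: "\<And>k. f (vQ k) = vQ (q k)" using Q by metis
  obtain r where r: "\<And>k. r k \<in> {0..<2} \<and> f (vR k) = vR (r k)" using R by metis
  have pq: "even (k + l) \<longleftrightarrow> even (p k + q l)" for k l
    using adj[of "vP k" "vQ l"] p[of k] q[of l] by (simp add: adj_vPQR)
  have pp: "p k mod 4 = p l mod 4 \<longleftrightarrow> k mod 4 = l mod 4" for k l
    using f_inj[of "vP k" "vP l"] p[of k] p[of l] by (simp add: vP_eq_iff)
  have rr: "r k mod 2 = r l mod 2 \<longleftrightarrow> k mod 2 = l mod 2" for k l
    using f_inj[of "vR k" "vR l"] r[of k] r[of l] by (simp add: vR_eq_iff)
  \<comment> \<open>Adjacency with Q makes \<open>p 1 - p 0\<close> odd, so \<open>p 1\<close> is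
    \<open>p 0 + 1\<close> or \<open>p 0 - 1\<close> modulo 4; \<open>s\<close> records whether the
    cyclic order is kept or reversed.\<close>
  define s :: int where "s = (if p 1 mod 4 = (p 0 + 1) mod 4 then 0 else 1)"
  have parity: "even (p k - p 0) \<longleftrightarrow> even k" for k using pq[of k 0] pq[of 0 0] by auto
  have p1: "p 1 mod 4 = (p 0 + sg s) mod 4"
    using two_more_or_less(2)[of "p 1" "p 0"] parity[of 1] by (simp add: s_def sg_def)
  have p2: "p 2 mod 4 = (p 0 + 2) mod 4"
    using two_more_or_less(1)[of "p 2" "p 0"] parity[of 2] pp[of 2 0] by simp
  have p3: "p 3 mod 4 = (p 1 + 2) mod 4"
    using two_more_or_less(1)[of "p 3" "p 1"] parity[of 3] parity[of 1] pp[of 3 1] by simp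
  have "f = dihedral_act ((p 0, s), r 0)"
  proof (rule eq_on_verts13I)
    show "f \<in> extensional (yoke_verts 1 3)" using f by (simp add: carrier_yoke_aut Bij_def)
  next
    fix k
    have "p k mod 4 = (p 0 + sg s * k) mod 4"
    proof -
      \<comment> \<open>Both congruences rest on \<open>2\<close> and \<open>-2\<close> being equal
        modulo 4.\<close>
      have step: "(p 0 + sg s * 2) mod 4 = (p 0 + 2) mod 4" "(p 0 + sg s * 3) mod 4 = (p 0 + sg s + 2) mod 4"
        using sg_cases[of s] by (elim disjE; simp add: mod_eq_dvd_iff)+
      have p3'': "p 3 mod 4 = (p 0 + sg s + 2) mod 4"
        using p3 p1 by (metis mod_add_left_eq)
      have "p (k mod 4) mod 4 = (p 0 + sg s * (k mod 4)) mod 4"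
      proof -
        consider "k mod 4 = 0" | "k mod 4 = 1" | "k mod 4 = 2" | "k mod 4 = 3" using mod4_cases[of k] by blast
        then show ?thesis
        proof cases
          case 1 show ?thesis unfolding 1 by simp
        next
          case 2 show ?thesis unfolding 2 p1 by simp
        next
          case 3 show ?thesis unfolding 3 p2 step ..
        next
          case 4 show ?thesis unfolding 4 p3'' step ..
        qed
      qed
      moreover have "p (k mod 4) mod 4 = p k mod 4" unfolding pp by simp
      ultimately show ?thesis by (simp only: mod4_affine)
    qed
    then show "f (vP k) = dihedral_act ((p 0, s), r 0) (vP k)" using p[of k] by (simp add: dihedral_act_vPQR vP_eq_iff)
    \<comment> \<open>The parity rule between P and Q determines \<open>q\<close> modulo 2 from
      \<open>p 0\<close> alone.\<close>
    have "q k mod 2 = (p 0 + k) mod 2" using pq[of 0 k] by (auto simp: mod_eq_dvd_iff)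
    then show "f (vQ k) = dihedral_act ((p 0, s), r 0) (vQ k)" using q[of k] by (simp add: dihedral_act_vPQR vQ_eq_iff)
    \<comment> \<open>R has two elements, so injectivity determines \<open>r\<close> from
      \<open>r 0\<close>.\<close>
    have "r k mod 2 = (r 0 + k) mod 2" using rr[of k 0] rr[of k 1] rr[of 0 1]
      unfolding mod_eq_dvd_iff by auto
    then show "f (vR k) = dihedral_act ((p 0, s), r 0) (vR k)" using r[of k] by (simp add: dihedral_act_vPQR vR_eq_iff)
  qed (rule dihedral_act_extensional)
  moreover have "((p 0, s), r 0) \<in> carrier (dihedral4 \<times>\<times> cyclic2)"
    using p[of 0] r[of 0] by (auto simp: DirProd_def dihedral4_simps cyclic2_simps s_def)
  ultimately show ?thesis by blast
qed

lemma yoke_aut_1_3: "yoke_aut 1 3 \<cong> dihedral4 \<times>\<times> cyclic2"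
proof -
  have "group (dihedral4 \<times>\<times> cyclic2)"
    using group_dihedral4 by (intro DirProd_group) (simp_all add: cyclic2_def)
  moreover have "dihedral_act \<in> iso (dihedral4 \<times>\<times> cyclic2) (yoke_aut 1 3)"
    unfolding iso_iff using dihedral_act_surj dihedral_act_in_yoke_aut inj_on_dihedral_act dihedral_act_mult by (auto intro!: homI)
  ultimately show ?thesis using group.iso_sym is_isoI by blast
qed

theorem theorem6p13:
  shows "yoke_aut 1 3 \<cong> dihedral4 \<times>\<times> cyclic2
    \<and> (\<forall>n m :: nat. n \<ge> 1 \<and> m \<noteq> 2 \<and> (n, m) \<noteq> (1, 3) \<longrightarrow>
           yoke_aut n m \<cong> yoke_A n m)"
  using yoke_aut_1_3 by (auto simp: yoke_A_eq_yoke_aut)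

end
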